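(* Let $N\ge 2$, $p\in[2,\infty[$ with $p>N$, $r_0>e$, $C_H=\left|\frac{p-N}{p}\right|^p$, $C_*=\frac{p-1}{2p}\left|\frac{p-N}{p}\right|^{p-2}$, $\varepsilon\in\,]0,C_*]$, and consider the equation $$-\Delta_p u-\frac{C_H}{|x|^p}|u|^{p-2}u-\frac{\varepsilon}{|x|^p\log^{2}|x|}|u|^{p-2}u=0\quad\text{in }B]r_0,\infty[.$$ Let $\beta_\varepsilon\le\bar\beta_\varepsilon$ be the real roots of $\frac12\left|\frac{p-N}{p}\right|^{p-2}(p-1)(2-\beta p)\beta=\varepsilon$. Then: (a) for every positive radial strictly monotone increasing $C^2$ strict supersolution $v$ of the equation and every $\tau<0$ there is $C>0$ with $$|x|^{\frac{p-N}{p}}(\log|x|)^{\beta_\varepsilon}(\log\log|x|)^\tau\le C\,v(x)\quad\text{for all }x\in B[r_0,\infty[;$$ (b) for every positive (not necessarily radial or increasing) $C^2$-supersolution $w$ of the equation, $$\limsup_{|x|\to\infty}\frac{|x|^{\frac{p-N}{p}}(\log|x|)^{\bar\beta_\varepsilon}(\log\log|x|)^\tau}{w(x)}>0$$ whenever either $\varepsilon<C_*$ and $\tau>0$, or $\varepsilon=C_*$ and $\tau>2/p$.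
   Context: $\Delta_p u=\nabla\cdot(|\nabla u|^{p-2}\nabla u)$. $B]r_0,\infty[=\{x\in\mathbb{R}^N:|x|>r_0\}$, $B[r_0,\infty[=\{x:|x|\ge r_0\}$. A $C^2$-supersolution is a function $w\in C^2(B[r_0,\infty[)$ for which the left-hand side of the equation evaluated at $w$ is $\ge 0$ pointwise in $B]r_0,\infty[$; a strict supersolution has $>0$ at every point. A radial function $v(x)=\phi(|x|)$ is strictly monotone increasing if $\phi'(r)>0$ for all $r\ge r_0$. (For $0<\varepsilon<C_*$ one has $0<\beta_\varepsilon<\frac1p<\bar\beta_\varepsilon<\frac2p$, and for $\varepsilon=C_*$, $\beta_\varepsilon=\bar\beta_\varepsilon=\frac1p$.) *)

theory Defs
  imports "HOL-Analysis.Analysis"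
begin

definition pd :: "'n::finite \<Rightarrow> (real^'n \<Rightarrow> real) \<Rightarrow> real^'n \<Rightarrow> real" where
  "pd i u x = frechet_derivative u (at x) (axis i 1)"

definition grad :: "(real^'n::finite \<Rightarrow> real) \<Rightarrow> real^'n \<Rightarrow> real^'n" where
  "grad u x = (\<chi> i. pd i u x)"

definition plap :: "real \<Rightarrow> (real^'n::finite \<Rightarrow> real) \<Rightarrow> real^'n \<Rightarrow> real" where
  "plap p u x = (\<Sum>i\<in>UNIV. pd i (\<lambda>y. (norm (grad u y)) powr (p - 2) * (grad u y $ i)) x)"

definition C2_on :: "(real^'n::finite) set \<Rightarrow> (real^'n \<Rightarrow> real) \<Rightarrow> bool" where
  "C2_on T u \<longleftrightarrow> u differentiable_on T \<and>
     (\<forall>i. (\<lambda>x. pd i u x) differentiable_on T) \<and>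
     (\<forall>i j. continuous_on T (\<lambda>x. pd j (\<lambda>y. pd i u y) x))"

definition C2_ext :: "real \<Rightarrow> (real^'n::finite \<Rightarrow> real) \<Rightarrow> bool" where
  "C2_ext r0 u \<longleftrightarrow> (\<exists>T. open T \<and> {x. norm x \<ge> r0} \<subseteq> T \<and> C2_on T u)"

definition Lop :: "real \<Rightarrow> real \<Rightarrow> real \<Rightarrow> (real^'n::finite \<Rightarrow> real) \<Rightarrow> real^'n \<Rightarrow> real" where
  "Lop p CH \<epsilon> u x =
     - plap p u x
     - CH / (norm x powr p) * (\<bar>u x\<bar> powr (p - 2) * u x)
     - \<epsilon> / (norm x powr p * (ln (norm x))\<^sup>2) * (\<bar>u x\<bar> powr (p - 2) * u x)"

definition supersol :: "real \<Rightarrow> real \<Rightarrow> real \<Rightarrow> real \<Rightarrow> (real^'n::finite \<Rightarrow> real) \<Rightarrow> bool" where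
  "supersol p CH \<epsilon> r0 w \<longleftrightarrow> C2_ext r0 w \<and> (\<forall>x. norm x > r0 \<longrightarrow> Lop p CH \<epsilon> w x \<ge> 0)"

definition strict_supersol :: "real \<Rightarrow> real \<Rightarrow> real \<Rightarrow> real \<Rightarrow> (real^'n::finite \<Rightarrow> real) \<Rightarrow> bool" where
  "strict_supersol p CH \<epsilon> r0 w \<longleftrightarrow> C2_ext r0 w \<and> (\<forall>x. norm x > r0 \<longrightarrow> Lop p CH \<epsilon> w x > 0)"

definition radial_strict_incr :: "real \<Rightarrow> (real^'n::finite \<Rightarrow> real) \<Rightarrow> bool" where
  "radial_strict_incr r0 v \<longleftrightarrow> (\<exists>\<phi>::real \<Rightarrow> real.
     (\<forall>x. norm x \<ge> r0 \<longrightarrow> v x = \<phi> (norm x)) \<and>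
     (\<forall>r\<ge>r0. \<exists>d>0. (\<phi> has_real_derivative d) (at r within {r0..})))"

end

theory Submission
  imports Defs
begin

text \<open>
  With \<open>\<gamma> = (p - N) / p\<close> and \<open>s = log |x|\<close>, a radial profile \<open>exp (H (log |x|))\<close> with \<open>y = H'\<close> positive is a
  supersolution iff \<open>y' + R(s, y) \<le> 0\<close> for an explicit Riccati term \<open>R\<close>. Writing \<open>y = \<gamma> + q / s\<close>, this becomes
  \<open>s q' \<le> - (p/2) (q - \<beta>) (q - \<beta>b) + O(1/s)\<close>, where \<open>\<beta>, \<beta>b\<close> are the two roots of the indicial equation.
  By the second derivative test along lines, a radial profile touching a supersolution from below satisfies
  the Riccati inequality at the point of contact.

  (a) If \<open>q\<close> once falls below \<open>\<beta> + \<tau> / log s\<close> far out, it keeps decreasing logarithmically and becomes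
  negative, which is impossible since \<open>y > \<gamma>\<close>. Integrating \<open>q / s\<close> gives the lower bound.

  (b) If the quotient tends to zero, glue two strict radial subsolutions at \<open>s = S\<close>: inside,
  \<open>|x|\<^sup>\<gamma> (s - S/2)\<close>, which vanishes at \<open>s = S/2\<close>; outside, a profile with the growth of the numerator
  starting from a larger \<open>q\<close>. Divided by \<open>w\<close>, each attains its maximum on the sphere \<open>s = S\<close> at the
  minimum point of \<open>w\<close>, and the two resulting bounds on the radial derivative of \<open>w\<close> contradict each other.
\<close>

section \<open>Gradient, Hessian, and the pointwise form of the p-Laplacian\<close>

lemma has_derivative_grad:
  fixes u :: "real^'n::finite \<Rightarrow> real"
  assumes "u differentiable (at x)"
  shows "(u has_derivative (\<lambda>h. grad u x \<bullet> h)) (at x)"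
proof -
  let ?D = "frechet_derivative u (at x)"
  have D: "(u has_derivative ?D) (at x)"
    using assms frechet_derivative_works by blast
  then have lin: "linear ?D"
    by (simp add: has_derivative_linear)
  have "?D h = grad u x \<bullet> h" for h
  proof -
    have "?D h = ?D (\<Sum>i\<in>UNIV. h $ i *\<^sub>R axis i 1)"
      using basis_expansion[of h] by (simp add: scalar_mult_eq_scaleR)
    also have "\<dots> = (\<Sum>i\<in>UNIV. h $ i * ?D (axis i 1))"
      by (simp add: linear_sum[OF lin] linear_scale[OF lin])
    also have "\<dots> = grad u x \<bullet> h"
      by (simp add: grad_def pd_def inner_vec_def mult.commute)
    finally show ?thesis .
  qed
  then have "?D = (\<lambda>h. grad u x \<bullet> h)" by blast
  with D show ?thesis by simp
qed

lemma pd_eq_of_has_derivative: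
  "(u has_derivative D) (at x) \<Longrightarrow> pd i u x = D (axis i 1)"
  unfolding pd_def by (metis frechet_derivative_at)

lemma has_derivative_vec_grad:
  fixes u :: "real^'n::finite \<Rightarrow> real"
  assumes "\<And>i. pd i u differentiable (at x)"
  shows "(grad u has_derivative (\<lambda>h. \<chi> i. grad (pd i u) x \<bullet> h)) (at x)"
proof (rule has_derivative_componentwise_within[THEN iffD2], rule ballI)
  fix b :: "real^'n" assume "b \<in> Basis"
  then obtain i where b: "b = axis i 1" by (auto simp: Basis_vec_def)
  show "((\<lambda>y. grad u y \<bullet> b) has_derivative (\<lambda>h. (\<chi> i. grad (pd i u) x \<bullet> h) \<bullet> b)) (at x)"
    using has_derivative_grad[OF assms, of i] by (simp add: b inner_axis grad_def[of u])
qed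

lemma C2_ext_differentiable:
  assumes "C2_ext r0 w" "norm x \<ge> r0"
  shows "w differentiable (at x)" "pd i w differentiable (at x)"
proof -
  obtain T where "open T" "{x. norm x \<ge> r0} \<subseteq> T" "C2_on T w"
    using assms unfolding C2_ext_def by blast
  moreover from this have "x \<in> T" using assms by blast
  ultimately show "w differentiable (at x)" "pd i w differentiable (at x)"
    unfolding C2_on_def differentiable_on_def
    by (metis at_within_open)+
qed

lemma C2_ext_continuous_on:
  assumes "C2_ext r0 w" "S \<subseteq> {x. norm x \<ge> r0}"
  shows "continuous_on S w"
  using C2_ext_differentiable(1)[OF assms(1)] assms(2)
  by (auto intro!: continuous_at_imp_continuous_on differentiable_imp_continuous_within)

text \<open>Away from critical points \<open>norm\<close> is differentiable, so the product and
  chain rules apply to each component of the flux. With \<open>A\<close> the derivative of the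
  gradient field, the factor \<open>norm (grad w)\<close> contributes \<open>(p - 2)\<close> times
  the second derivative in the gradient direction \<open>n\<close>, and the components themselves
  contribute the trace of \<open>A\<close>.\<close>

lemma plap_eq:
  fixes w :: "real^'n::finite \<Rightarrow> real"
  assumes d: "\<And>i. pd i w differentiable (at x)" and g: "grad w x = c *\<^sub>R n" and n: "norm n = 1" and c: "c > 0"
  defines "A \<equiv> \<lambda>h. \<chi> i. grad (pd i w) x \<bullet> h"
  shows "plap p w x = c powr (p - 2) * ((p - 2) * (n \<bullet> A n) + (\<Sum>i\<in>UNIV. axis i 1 \<bullet> A (axis i 1)))"
proof -
  have gd: "(grad w has_derivative A) (at x)"
    unfolding A_def by (rule has_derivative_vec_grad[OF d])
  have linA: "linear A" using gd has_derivative_linear by blast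
  have g0: "grad w x \<noteq> 0" using g n c by auto
  have ng: "norm (grad w x) = c" using g n c by simp
  have nd: "((\<lambda>y. norm (grad w y)) has_derivative (\<lambda>h. n \<bullet> A h)) (at x)"
  proof -
    have "((\<lambda>y. norm (grad w y)) has_derivative (\<lambda>h. A h \<bullet> sgn (grad w x))) (at x)"
      using has_derivative_compose[OF gd has_derivative_norm[OF g0]] by simp
    moreover have "sgn (grad w x) = n" using g n c by (simp add: sgn_div_norm)
    ultimately show ?thesis by (simp add: inner_commute)
  qed
  have pd: "((\<lambda>y. norm (grad w y) powr (p - 2)) has_derivative (\<lambda>h. (p - 2) * c powr (p - 3) * (n \<bullet> A h))) (at x)"
  proof -
    have "((\<lambda>z. z powr (p - 2)) has_real_derivative (p - 2) * c powr (p - 2 - 1)) (at c)"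
      using has_real_derivative_powr[OF c] .
    then have "((\<lambda>z. z powr (p - 2)) has_derivative (\<lambda>h. (p - 2) * c powr (p - 3) * h)) (at (norm (grad w x)))"
      using ng by (simp add: has_field_derivative_def)
    from has_derivative_compose[OF nd this] show ?thesis by simp
  qed
  have cd: "((\<lambda>y. grad w y $ i) has_derivative (\<lambda>h. A h $ i)) (at x)" for i
    using bounded_linear.has_derivative[OF bounded_linear_vec_nth gd] .
  have "plap p w x = (\<Sum>i\<in>UNIV. c powr (p - 2) * (A (axis i 1) $ i) + (p - 2) * c powr (p - 3) * (n \<bullet> A (axis i 1)) * (c * n $ i))"
    unfolding plap_def
  proof (rule sum.cong[OF refl])
    fix i
    from has_derivative_mult[OF pd cd[of i]]
    show "pd i (\<lambda>y. norm (grad w y) powr (p - 2) * (grad w y $ i)) x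
      = c powr (p - 2) * (A (axis i 1) $ i) + (p - 2) * c powr (p - 3) * (n \<bullet> A (axis i 1)) * (c * n $ i)"
      by (subst pd_eq_of_has_derivative) (auto simp: ng, simp add: g)
  qed
  also have "\<dots> = c powr (p - 2) * (\<Sum>i\<in>UNIV. A (axis i 1) $ i) + (p - 2) * (c powr (p - 3) * c) * (\<Sum>i\<in>UNIV. n $ i * (n \<bullet> A (axis i 1)))"
    by (simp add: sum.distrib sum_distrib_left mult_ac)
  also have "c powr (p - 3) * c = c powr (p - 2)"
    using powr_mult_base[of c "p - 3"] c by (simp add: mult.commute)
  also have "(\<Sum>i\<in>UNIV. n $ i * (n \<bullet> A (axis i 1))) = n \<bullet> A n"
  proof -
    have "A n = A (\<Sum>i\<in>UNIV. n $ i *\<^sub>R axis i 1)"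
      using basis_expansion[of n] by (simp add: scalar_mult_eq_scaleR)
    also have "\<dots> = (\<Sum>i\<in>UNIV. n $ i *\<^sub>R A (axis i 1))"
      by (simp add: linear_sum[OF linA] linear_scale[OF linA])
    finally show ?thesis by (simp add: inner_sum_right)
  qed
  also have "(\<Sum>i\<in>UNIV. A (axis i 1) $ i) = (\<Sum>i\<in>UNIV. axis i 1 \<bullet> A (axis i 1))"
    by (simp add: inner_axis')
  finally show ?thesis by (simp add: algebra_simps)
qed

section \<open>Contact of a supersolution with a radial profile from below\<close>

text \<open>If \<open>l < 0\<close>, then \<open>f'\<close> is negative just to the right of its
  zero at 0, and the mean value theorem for \<open>f\<close> produces smaller values there. This
  asks for a derivative of \<open>f'\<close> at 0 only, which is all that a profile has to supply at
  the contact point.\<close>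

lemma local_min_second_derivative_nonneg:
  fixes f f' :: "real \<Rightarrow> real"
  assumes e: "e > 0" and d: "\<And>t. \<bar>t\<bar> < e \<Longrightarrow> (f has_real_derivative f' t) (at t)"
    and d2: "(f' has_real_derivative l) (at 0)"
    and min: "\<And>t. \<bar>t\<bar> < e \<Longrightarrow> f 0 \<le> f t"
  shows "f' 0 = 0" "l \<ge> 0"
proof -
  show z: "f' 0 = 0"
    using DERIV_local_min[OF d[of 0] e] e min by simp
  show "l \<ge> 0"
  proof (rule ccontr)
    assume "\<not> l \<ge> 0"
    then obtain k where k: "k > 0" "\<And>h. 0 < h \<Longrightarrow> h < k \<Longrightarrow> f' h < 0"
      using DERIV_neg_dec_right[OF d2] z by auto
    define h where "h = min e k / 2"
    have h: "0 < h" "h < e" "h < k" using e k by (auto simp: h_def)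
    obtain z where "0 < z" "z < h" "f h - f 0 = (h - 0) * f' z"
      using MVT2[of 0 h f f'] d h by force
    then have "f h < f 0" using k(2)[of z] h by (smt (verit) mult_pos_neg)
    then show False using min[of h] h by simp
  qed
qed

lemma has_real_derivative_norm_line:
  fixes x d :: "'a::real_inner"
  assumes "x + t *\<^sub>R d \<noteq> 0"
  shows "((\<lambda>t. norm (x + t *\<^sub>R d)) has_real_derivative ((x + t *\<^sub>R d) \<bullet> d) / norm (x + t *\<^sub>R d)) (at t)"
proof -
  have "((\<lambda>t. norm (x + t *\<^sub>R d)) has_derivative (\<lambda>h. (h *\<^sub>R d) \<bullet> sgn (x + t *\<^sub>R d))) (at t)"
    by (rule has_derivative_compose[where f="\<lambda>t. x + t *\<^sub>R d" and g=norm, OF _ has_derivative_norm])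
      (auto intro!: derivative_eq_intros simp: assms)
  then show ?thesis
    unfolding has_field_derivative_def
    by (rule has_derivative_eq_rhs) (auto simp: sgn_div_norm inner_commute[of d] divide_inverse)
qed

lemma has_real_derivative_grad_line:
  fixes u :: "real^'n::finite \<Rightarrow> real"
  assumes "u differentiable (at (x + t *\<^sub>R d))"
  shows "((\<lambda>t. u (x + t *\<^sub>R d)) has_real_derivative grad u (x + t *\<^sub>R d) \<bullet> d) (at t)"
proof -
  have "((\<lambda>t. u (x + t *\<^sub>R d)) has_derivative (\<lambda>h. grad u (x + t *\<^sub>R d) \<bullet> (h *\<^sub>R d))) (at t)"
    by (rule has_derivative_compose[where f="\<lambda>t. x + t *\<^sub>R d", OF _ has_derivative_grad])
      (auto intro!: derivative_eq_intros simp: assms)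
  then show ?thesis
    unfolding has_field_derivative_def
    by (rule has_derivative_eq_rhs) (auto simp: field_simps)
qed

text \<open>The difference of \<open>w\<close> and the radial profile has a local minimum at
  \<open>x0\<close>. Testing it along every line through \<open>x0\<close> makes the gradients agree
  and bounds the Hessian of \<open>w\<close> below by that of the profile, whose eigenvalues are
  \<open>f2\<close> in the radial direction and \<open>f1 / r\<close> in the tangential ones. Since
  \<open>p \<ge> 2\<close>, the formula of \<open>plap_eq\<close> is monotone in these second
  derivatives.\<close>

lemma plap_ge_radial_touching_below:
  fixes w :: "real^'n::finite \<Rightarrow> real" and f f1 :: "real \<Rightarrow> real"
  assumes C2: "C2_ext r0 w" and r0: "0 < r0" "r0 \<le> a"
    and x0: "a < norm x0" "norm x0 < b"
    and f: "\<And>r. a < r \<Longrightarrow> r < b \<Longrightarrow> (f has_real_derivative f1 r) (at r)"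
    and f1: "(f1 has_real_derivative f2) (at (norm x0))" "f1 (norm x0) > 0"
    and below: "\<And>x. a < norm x \<Longrightarrow> norm x < b \<Longrightarrow> f (norm x) \<le> w x"
    and touch: "f (norm x0) = w x0"
    and p: "p \<ge> 2"
  shows "plap p w x0 \<ge> f1 (norm x0) powr (p - 2) *
           ((p - 1) * f2 + (real CARD('n) - 1) * f1 (norm x0) / norm x0)"
proof -
  define r where "r = norm x0"
  define n where "n = x0 /\<^sub>R r"
  define A where "A = (\<lambda>h. \<chi> i. grad (pd i w) x0 \<bullet> h)"
  have r: "r > 0" "a < r" "r < b" using r0 x0 by (auto simp: r_def)
  have nn: "norm n = 1" using r by (simp add: n_def r_def)
  have x0n: "x0 = r *\<^sub>R n" using r by (simp add: n_def)
  have pdd: "pd i w differentiable (at x0)" for i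
    using C2_ext_differentiable(2)[OF C2] r0 x0 by simp
  have gd: "(grad w has_derivative A) (at x0)"
    unfolding A_def by (rule has_derivative_vec_grad[OF pdd])
  have "open {x::real^'n. a < norm x \<and> norm x < b}"
    by (intro open_Collect_conj open_Collect_less continuous_intros)
  then obtain e where e: "e > 0" "ball x0 e \<subseteq> {x. a < norm x \<and> norm x < b}"
    using x0 by (metis (mono_tags, lifting) mem_Collect_eq openE)
  have line: "grad w x0 \<bullet> d = f1 r * (n \<bullet> d) \<and>
      d \<bullet> A d \<ge> f2 * (n \<bullet> d)\<^sup>2 + f1 r * (1 - (n \<bullet> d)\<^sup>2) / r" if d: "norm d = 1" for d
  proof -
    define l where "l = (\<lambda>t. x0 + t *\<^sub>R d)"
    have l: "a < norm (l t)" "norm (l t) < b" "l t \<noteq> 0" "norm (l t) \<noteq> 0" if "\<bar>t\<bar> < e" for t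
    proof -
      have "l t \<in> ball x0 e" using that d by (simp add: l_def dist_norm)
      then show "a < norm (l t)" "norm (l t) < b" using e by auto
      then show "l t \<noteq> 0" "norm (l t) \<noteq> 0" using r0 by auto
    qed
    have l0: "l 0 = x0" by (simp add: l_def)
    have ld: "(l has_derivative (\<lambda>h. h *\<^sub>R d)) (at t)" for t
      unfolding l_def by (auto intro!: derivative_eq_intros)
    define k where "k = (\<lambda>t. (l t \<bullet> d) / norm (l t))"
    define \<psi> where "\<psi> = (\<lambda>t. w (l t) - f (norm (l t)))"
    define \<psi>' where "\<psi>' = (\<lambda>t. grad w (l t) \<bullet> d - f1 (norm (l t)) * k t)"
    have nl: "((\<lambda>t. norm (l t)) has_real_derivative k t) (at t)" if "\<bar>t\<bar> < e" for t
      using has_real_derivative_norm_line[of x0 t d] l[OF that] unfolding l_def k_def by simp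
    have 1: "(\<psi> has_real_derivative \<psi>' t) (at t)" if "\<bar>t\<bar> < e" for t
    proof -
      have "w differentiable (at (l t))"
        using C2_ext_differentiable(1)[OF C2] l[OF that] r0 by simp
      then have "((\<lambda>t. w (l t)) has_real_derivative grad w (l t) \<bullet> d) (at t)"
        using has_real_derivative_grad_line unfolding l_def by blast
      moreover have "((\<lambda>t. f (norm (l t))) has_real_derivative f1 (norm (l t)) * k t) (at t)"
        using DERIV_chain2[OF f nl[OF that]] l[OF that] by simp
      ultimately show ?thesis unfolding \<psi>_def \<psi>'_def by (rule DERIV_diff)
    qed
    have k0: "k 0 = n \<bullet> d" using r by (simp add: k_def l0 n_def r_def inner_commute divide_inverse)
    \<comment> \<open>The second derivative of the distance to the origin along the line: zero
      radially, \<open>1 / r\<close> tangentially.\<close>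
    have kd: "(k has_real_derivative (1 - (n \<bullet> d)\<^sup>2) / r) (at 0)"
    proof -
      have "((\<lambda>t. l t \<bullet> d) has_real_derivative d \<bullet> d) (at 0)"
        using has_derivative_inner_left[OF ld[of 0], of d] unfolding has_field_derivative_def
        by (simp add: mult_commute_abs)
      from DERIV_divide[OF this nl[of 0]] e(1) l[of 0]
      have "(k has_real_derivative ((d \<bullet> d) * norm (l 0) - (l 0 \<bullet> d) * k 0) / (norm (l 0) * norm (l 0))) (at 0)"
        unfolding k_def by simp
      moreover have "((d \<bullet> d) * norm (l 0) - (l 0 \<bullet> d) * k 0) / (norm (l 0) * norm (l 0)) = (1 - (n \<bullet> d)\<^sup>2) / r"
        using r d by (simp add: k0 l0 r_def[symmetric] dot_square_norm)
          (simp add: x0n power2_eq_square field_simps)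
      ultimately show ?thesis by simp
    qed
    have 2: "(\<psi>' has_real_derivative (A d \<bullet> d - (f1 r * ((1 - (n \<bullet> d)\<^sup>2) / r) + f2 * (n \<bullet> d) * (n \<bullet> d)))) (at 0)"
    proof -
      have "((\<lambda>t. grad w (l t)) has_derivative (\<lambda>h. A (h *\<^sub>R d))) (at 0)"
        using has_derivative_compose[OF ld[of 0], of "grad w"] gd l0 by simp
      from has_derivative_inner_left[OF this, of d]
      have g: "((\<lambda>t. grad w (l t) \<bullet> d) has_real_derivative A d \<bullet> d) (at 0)"
        unfolding has_field_derivative_def
        by (rule has_derivative_eq_rhs) (use has_derivative_linear[OF gd] in \<open>auto simp: linear_scale mult.commute\<close>)
      have "((\<lambda>t. f1 (norm (l t))) has_real_derivative f2 * k 0) (at 0)"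
        using DERIV_chain2[OF _ nl[of 0], of f1] f1 e l0 by (simp add: r_def)
      from DERIV_mult[OF this kd] have
        "((\<lambda>t. f1 (norm (l t)) * k t) has_real_derivative (f1 r * ((1 - (n \<bullet> d)\<^sup>2) / r) + f2 * (n \<bullet> d) * (n \<bullet> d))) (at 0)"
        by (simp add: l0 k0 r_def[symmetric] add.commute mult.commute)
      from DERIV_diff[OF g this] show ?thesis unfolding \<psi>'_def .
    qed
    have 3: "\<psi> 0 \<le> \<psi> t" if "\<bar>t\<bar> < e" for t
      using below[of "l t"] l[OF that] touch by (simp add: \<psi>_def l0)
    note * = local_min_second_derivative_nonneg[OF e(1) 1 2 3]
    show ?thesis using * by (simp add: \<psi>'_def l0 k0 r_def[symmetric] inner_commute power2_eq_square)
  qed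
  have g: "grad w x0 = f1 r *\<^sub>R n"
  proof (rule vec_eq_iff[THEN iffD2], rule allI)
    fix i show "grad w x0 $ i = (f1 r *\<^sub>R n) $ i"
      using line[of "axis i 1"] by (simp add: inner_axis)
  qed
  have "plap p w x0 = f1 r powr (p - 2) * ((p - 2) * (n \<bullet> A n) + (\<Sum>i\<in>UNIV. axis i 1 \<bullet> A (axis i 1)))"
    unfolding A_def using plap_eq[OF pdd g nn] f1 by (simp add: r_def)
  \<comment> \<open>The direction \<open>n\<close> handles the term with \<open>p - 2\<close>, the
    coordinate directions handle the trace.\<close>
  also have "\<dots> \<ge> f1 r powr (p - 2) * ((p - 2) * f2 + (\<Sum>i\<in>UNIV. f2 * (n $ i)\<^sup>2 + f1 r * (1 - (n $ i)\<^sup>2) / r))"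
  proof (intro mult_left_mono add_mono sum_mono)
    show "f2 \<le> n \<bullet> A n" using line[OF nn] nn by (simp add: dot_square_norm)
    show "f2 * (n $ i)\<^sup>2 + f1 r * (1 - (n $ i)\<^sup>2) / r \<le> axis i 1 \<bullet> A (axis i 1)" for i
      using line[of "axis i 1"] by (simp add: inner_axis)
  qed (use p in auto)
  also have "(\<Sum>i\<in>UNIV. f2 * (n $ i)\<^sup>2 + f1 r * (1 - (n $ i)\<^sup>2) / r) = f2 + f1 r * (real CARD('n) - 1) / r"
  proof -
    have "(\<Sum>i\<in>UNIV. (n $ i)\<^sup>2) = 1"
      using nn by (simp add: norm_vec_def L2_set_def)
    then show ?thesis
      by (simp add: sum.distrib sum_distrib_left[symmetric] sum_divide_distrib[symmetric] sum_subtractf)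
  qed
  finally show ?thesis
    by (simp add: r_def algebra_simps)
qed

section \<open>Reduction to a Riccati inequality in logarithmic variables\<close>

text \<open>The radial equation for \<open>y\<close> divided by \<open>(p - 1) y\<^sup>p\<^sup>-\<^sup>2\<close>, hence the power \<open>2 - p\<close>; meant for \<open>y > 0\<close>.\<close>
definition riccati :: "real \<Rightarrow> real \<Rightarrow> real \<Rightarrow> real \<Rightarrow> real \<Rightarrow> real" where
  "riccati p \<gamma> \<epsilon> s y = y\<^sup>2 - p * \<gamma> / (p - 1) * y + (\<gamma> powr p + \<epsilon> / s\<^sup>2) * y powr (2 - p) / (p - 1)"

lemma supersol_touched_riccati:
  fixes w :: "real^'n::finite \<Rightarrow> real" and H y :: "real \<Rightarrow> real"
  assumes C2: "C2_ext r0 w" and r0: "1 < r0" "r0 \<le> a"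
    and x0: "a < norm x0" "norm x0 < b"
    and H: "\<And>r. a < r \<Longrightarrow> r < b \<Longrightarrow> (H has_real_derivative y (ln r)) (at (ln r))"
    and y: "(y has_real_derivative y') (at (ln (norm x0)))" "y (ln (norm x0)) > 0"
    and below: "\<And>x. a < norm x \<Longrightarrow> norm x < b \<Longrightarrow> exp (H (ln (norm x))) \<le> w x"
    and touch: "exp (H (ln (norm x0))) = w x0"
    and p: "p \<ge> 2" and \<gamma>: "\<gamma> = (p - real CARD('n)) / p" and CH: "CH = \<gamma> powr p"
    and L: "Lop p CH \<epsilon> w x0 \<ge> 0"
  shows "y' + riccati p \<gamma> \<epsilon> (ln (norm x0)) (y (ln (norm x0))) \<le> 0"
proof -
  define f where "f = (\<lambda>r. exp (H (ln r)))"
  define f1 where "f1 = (\<lambda>r. f r * (y (ln r) / r))"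
  define r where "r = norm x0"
  define Y where "Y = y (ln r)"
  define f2 where "f2 = f r * (Y\<^sup>2 + y' - Y) / r\<^sup>2"
  define K where "K = f r powr (p - 2) * f r / r powr p"
  define M where "M = \<gamma> powr p + \<epsilon> / (ln r)\<^sup>2"
  have r: "r > 1" "r > 0" using x0 r0 by (auto simp: r_def)
  have f: "(f has_real_derivative f1 r) (at r)" if "a < r" "r < b" for r
  proof -
    have "((\<lambda>r. H (ln r)) has_real_derivative y (ln r) * (1 / r)) (at r)"
      by (rule DERIV_chain2[where f=H and g=ln, OF H[OF that] DERIV_ln_divide]) (use that r0 in simp)
    from DERIV_fun_exp[OF this] show ?thesis by (simp add: f_def f1_def mult.commute)
  qed
  have Y: "Y > 0" using y by (simp add: Y_def r_def)
  have fp: "f r > 0" by (simp add: f_def)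
  have "((\<lambda>r. y (ln r) / r) has_real_derivative (y' * (1 / r) * r - Y * 1) / (r * r)) (at r)"
    unfolding Y_def using y r
    by (intro DERIV_divide DERIV_chain2[of y] DERIV_ln_divide) (auto simp: r_def)
  from DERIV_mult[OF f this] x0
  have "(f1 has_real_derivative f1 r * (Y / r) + (y' * (1 / r) * r - Y * 1) / (r * r) * f r) (at r)"
    unfolding f1_def[abs_def] by (simp add: r_def Y_def)
  moreover have "f1 r * (Y / r) + (y' * (1 / r) * r - Y * 1) / (r * r) * f r = f2"
    using r unfolding f1_def f2_def Y_def[symmetric] by (simp add: field_simps power2_eq_square)
  ultimately have f2: "(f1 has_real_derivative f2) (at r)" by simp
  have f1p: "f1 r > 0" using Y fp r by (simp add: f1_def Y_def)
  have "f1 r powr (p - 2) * ((p - 1) * f2 + (real CARD('n) - 1) * f1 r / r) \<le> plap p w x0"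
    unfolding r_def
    by (rule plap_ge_radial_touching_below[OF C2 _ r0(2) x0 f _ _ _ _ p])
      (use r0 f2 f1p below touch in \<open>auto simp: r_def f_def\<close>)
  \<comment> \<open>With \<open>f' = f Y / r\<close> and \<open>f'' = f2\<close>, the term
    \<open>- (p - 1) Y\<close> coming from \<open>f2\<close> combines with \<open>(N - 1) Y\<close>
    to \<open>- (p - N) Y = - p \<gamma> Y\<close>. The factor \<open>K\<close> is what the
    p-Laplacian shares with both potential terms, so it can be cancelled.\<close>
  also have "f1 r powr (p - 2) * ((p - 1) * f2 + (real CARD('n) - 1) * f1 r / r)
      = K * (Y powr (p - 2) * ((p - 1) * (Y\<^sup>2 + y') - p * \<gamma> * Y))"
  proof -
    have "f1 r powr (p - 2) = f r powr (p - 2) * (Y powr (p - 2) / r powr (p - 2))"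
      unfolding f1_def using fp Y r by (simp add: Y_def[symmetric] powr_mult powr_divide)
    moreover have "r powr p = r powr (p - 2) * r\<^sup>2"
      using r by (simp add: powr_diff)
    moreover have "p * \<gamma> = p - real CARD('n)" using p \<gamma> by simp
    moreover have "(p - 1) * f2 + (real CARD('n) - 1) * f1 r / r
       = f r / r\<^sup>2 * ((p - 1) * (Y\<^sup>2 + y') - (p - real CARD('n)) * Y)"
      unfolding f2_def f1_def Y_def[symmetric] using r by (simp add: field_simps power2_eq_square)
    ultimately show ?thesis by (simp add: K_def)
  qed
  also have "plap p w x0 \<le> - M * K"
  proof -
    have "w x0 = f r" using touch by (simp add: f_def r_def)
    then have "Lop p CH \<epsilon> w x0 = - plap p w x0 - M * K"
      using fp by (simp add: Lop_def CH r_def[symmetric] M_def K_def add_divide_distrib distrib_left distrib_right mult_ac)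
    with L show ?thesis by simp
  qed
  finally have "K * (Y powr (p - 2) * ((p - 1) * (Y\<^sup>2 + y') - p * \<gamma> * Y) + M) \<le> 0"
    by (simp add: algebra_simps)
  moreover have "K > 0" using fp r by (simp add: K_def)
  ultimately have "Y powr (p - 2) * ((p - 1) * (Y\<^sup>2 + y') - p * \<gamma> * Y) + M \<le> 0"
    by (simp add: mult_le_0_iff)
  \<comment> \<open>This multiplier normalises the coefficient of \<open>y'\<close> to 1.\<close>
  then have "Y powr (2 - p) / (p - 1) * (Y powr (p - 2) * ((p - 1) * (Y\<^sup>2 + y') - p * \<gamma> * Y) + M) \<le> 0"
    using p by (intro mult_nonneg_nonpos) auto
  also have "Y powr (2 - p) / (p - 1) * (Y powr (p - 2) * ((p - 1) * (Y\<^sup>2 + y') - p * \<gamma> * Y) + M)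
     = (Y powr (2 - p) * Y powr (p - 2)) * (Y\<^sup>2 + y' - p * \<gamma> / (p - 1) * Y) + M * Y powr (2 - p) / (p - 1)"
  proof -
    have "A / k * (B * (k * Z - p * \<gamma> * Y) + M) = A * B * (Z - p * \<gamma> / k * Y) + M * A / k"
      if "k > 0" for A B k Z :: real
      using that by (simp add: field_simps)
    from this[of "p - 1"] p show ?thesis by simp
  qed
  also have "Y powr (2 - p) * Y powr (p - 2) = 1"
    using Y by (simp flip: powr_add)
  finally show ?thesis
    unfolding riccati_def M_def Y_def r_def by (simp add: algebra_simps)
qed

section \<open>Taylor bounds for negative powers and the expansion of the Riccati term\<close>

text \<open>Bernoulli's inequality, from \<open>ln (1 + u) \<le> u\<close> and
  \<open>exp z \<ge> 1 + z\<close>. It covers negative \<open>u\<close>, that is, values of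
  \<open>y\<close> below \<open>\<gamma>\<close>.\<close>

lemma powr_minus_ge_linear:
  fixes a u :: real
  assumes "a \<ge> 0" "u > -1"
  shows "(1 + u) powr (- a) \<ge> 1 - a * u"
proof -
  have "1 - a * u \<le> 1 + (- a * ln (1 + u))"
    using ln_add_one_self_le_self2[OF assms(2)] assms(1) by (simp add: mult_left_mono)
  also have "\<dots> \<le> exp (- a * ln (1 + u))"
    using exp_ge_add_one_self by blast
  finally show ?thesis using assms(2) by (simp add: powr_def)
qed

lemma has_real_derivative_powr_minus:
  fixes a x :: real
  assumes "x > -1"
  shows "((\<lambda>u. (1 + u) powr (- a)) has_real_derivative - a * (1 + x) powr (- a - 1)) (at x)"
proof -
  have "((\<lambda>u. 1 + u) has_real_derivative 1) (at x)"
    by (auto intro!: derivative_eq_intros)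
  from DERIV_fun_powr[OF this, of "- a"] assms show ?thesis
    by simp
qed

text \<open>The derivative of the difference of the two sides is \<open>a\<close> times the linear
  bound for the exponent \<open>a + 1\<close>, so integrating from 0 raises the order by one. The
  cubic bound arises from this one in the same way.\<close>

lemma powr_minus_le_quadratic:
  fixes a u :: real
  assumes a: "a \<ge> 0" and u: "u \<ge> 0"
  shows "(1 + u) powr (- a) \<le> 1 - a * u + a * (a + 1) / 2 * u\<^sup>2"
proof -
  define F where "F = (\<lambda>u. 1 - a * u + a * (a + 1) / 2 * u\<^sup>2 - (1 + u) powr (- a))"
  have "F 0 \<le> F u"
  proof (rule DERIV_nonneg_imp_nondecreasing[OF u])
    fix x assume x: "0 \<le> x" "x \<le> u"
    have "(F has_real_derivative a * ((1 + x) powr (- a - 1) - (1 - (a + 1) * x))) (at x)"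
      unfolding F_def using x
      by (auto intro!: derivative_eq_intros has_real_derivative_powr_minus simp: field_simps)
    moreover have "a * ((1 + x) powr (- a - 1) - (1 - (a + 1) * x)) \<ge> 0"
      using powr_minus_ge_linear[of "a + 1" x, unfolded minus_add_distrib, folded diff_conv_add_uminus] a x
      by (intro mult_nonneg_nonneg) auto
    ultimately show "\<exists>D. (F has_real_derivative D) (at x) \<and> 0 \<le> D" by blast
  qed
  then show ?thesis by (simp add: F_def)
qed

lemma powr_minus_ge_cubic:
  fixes a u :: real
  assumes a: "a \<ge> 0" and u: "u \<ge> 0"
  shows "(1 + u) powr (- a) \<ge> 1 - a * u + a * (a + 1) / 2 * u\<^sup>2 - a * (a + 1) * (a + 2) / 6 * u ^ 3"
proof -
  define F where "F = (\<lambda>u. (1 + u) powr (- a) - (1 - a * u + a * (a + 1) / 2 * u\<^sup>2 - a * (a + 1) * (a + 2) / 6 * u ^ 3))"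
  have "F 0 \<le> F u"
  proof (rule DERIV_nonneg_imp_nondecreasing[OF u])
    fix x assume x: "0 \<le> x" "x \<le> u"
    have "(F has_real_derivative a * ((1 - (a + 1) * x + (a + 1) * (a + 1 + 1) / 2 * x\<^sup>2) - (1 + x) powr (- a - 1))) (at x)"
      unfolding F_def using x
      by (auto intro!: derivative_eq_intros has_real_derivative_powr_minus simp: field_simps power2_eq_square)
    moreover have "a * ((1 - (a + 1) * x + (a + 1) * (a + 1 + 1) / 2 * x\<^sup>2) - (1 + x) powr (- a - 1)) \<ge> 0"
      using powr_minus_le_quadratic[of "a + 1" x, unfolded minus_add_distrib, folded diff_conv_add_uminus] a x
      by (intro mult_nonneg_nonneg) auto
    ultimately show "\<exists>D. (F has_real_derivative D) (at x) \<and> 0 \<le> D" by blast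
  qed
  then show ?thesis by (simp add: F_def)
qed

text \<open>For \<epsilon> = 0 the term has a double zero at \<open>y = \<gamma>\<close>. Replacing
  the power by its tangent at \<open>\<gamma>\<close> leaves exactly
  \<open>(y - \<gamma>)\<^sup>2\<close>, and the potential with \<epsilon> makes the inequality
  strict.\<close>

lemma riccati_gt:
  assumes p: "p \<ge> 2" and \<gamma>: "\<gamma> > 0" and \<epsilon>: "\<epsilon> > 0" and y: "y > 0" and s: "s \<noteq> 0"
  shows "riccati p \<gamma> \<epsilon> s y > (y - \<gamma>)\<^sup>2"
proof -
  define k where "k = p - 1"
  have k: "k > 0" and pk: "p = k + 1" using p by (auto simp: k_def)
  define u where "u = y / \<gamma> - 1"
  have u: "y = \<gamma> * (1 + u)" "u > -1" using y \<gamma> by (auto simp: u_def field_simps)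
  have yp: "\<gamma> powr p * y powr (2 - p) = \<gamma>\<^sup>2 * (1 + u) powr (- (p - 2))"
    using u \<gamma> by (simp add: powr_mult flip: powr_add)
  have "(y - \<gamma>)\<^sup>2 = y\<^sup>2 - p * \<gamma> / (p - 1) * y + \<gamma>\<^sup>2 * (1 - (p - 2) * u) / (p - 1)"
    using k unfolding u(1) pk by (simp add: field_simps power2_eq_square)
  also have "\<dots> \<le> y\<^sup>2 - p * \<gamma> / (p - 1) * y + \<gamma> powr p * y powr (2 - p) / (p - 1)"
    unfolding yp using powr_minus_ge_linear[of "p - 2" u] u p
    by (intro add_left_mono divide_right_mono mult_left_mono) auto
  also have "\<dots> < riccati p \<gamma> \<epsilon> s y"
    using p \<epsilon> y s by (simp add: riccati_def add_divide_distrib distrib_right)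
  finally show ?thesis .
qed

text \<open>Constant and linear terms cancel because of the double zero at \<open>\<gamma>\<close>;
  the square of \<open>y\<close> contributes 1 and the second Taylor coefficient
  \<open>(p - 2) / 2\<close>, which together give the factor \<open>p / 2\<close>. What remains is
  \<open>O(1 / s)\<close>, uniformly for \<open>q\<close> in \<open>[0, B]\<close>.\<close>

lemma riccati_expansion_ge:
  assumes p: "p \<ge> 2" and \<gamma>: "\<gamma> > 0" and \<epsilon>: "\<epsilon> > 0" and B: "B \<ge> 0"
  obtains C where "C > 0"
    "\<And>s q. s > 0 \<Longrightarrow> 0 \<le> q \<Longrightarrow> q \<le> B \<Longrightarrow>
       s\<^sup>2 * riccati p \<gamma> \<epsilon> s (\<gamma> + q / s) \<ge> p / 2 * q\<^sup>2 + \<epsilon> * \<gamma> powr (2 - p) / (p - 1) - C / s"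
proof
  define e where "e = \<epsilon> * \<gamma> powr (2 - p) / (p - 1)"
  \<comment> \<open>The first summand bounds the cubic Taylor term, the second the first-order loss
    in the term with \<epsilon>; the 1 makes \<open>C\<close> positive.\<close>
  define C where "C = p * (p - 2) / (6 * \<gamma>) * B ^ 3 + e * (p - 2) / \<gamma> * B + 1"
  have e: "e \<ge> 0" using p \<epsilon> by (simp add: e_def)
  show "C > 0" unfolding C_def using p B e \<gamma> by (intro add_nonneg_pos add_nonneg_nonneg) auto
  fix s q :: real assume s: "s > 0" and q: "0 \<le> q" "q \<le> B"
  define k where "k = p - 1"
  have k: "k > 0" and pk: "p = k + 1" using p by (auto simp: k_def)
  define u where "u = q / (\<gamma> * s)"
  define y where "y = \<gamma> + q / s"
  have u: "u \<ge> 0" using q s \<gamma> by (simp add: u_def)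
  have y: "y = \<gamma> * (1 + u)" using s \<gamma> by (simp add: u_def y_def field_simps)
  have qu: "q = u * \<gamma> * s" using s \<gamma> by (simp add: u_def)
  have yp: "\<gamma> powr p * y powr (2 - p) = \<gamma>\<^sup>2 * (1 + u) powr (- (p - 2))"
    using u \<gamma> y by (simp add: powr_mult flip: powr_add)
  have 1: "s\<^sup>2 * (y\<^sup>2 - p * \<gamma> / (p - 1) * y + \<gamma> powr p * y powr (2 - p) / (p - 1)) \<ge> p / 2 * q\<^sup>2 - p * (p - 2) / (6 * \<gamma>) * q ^ 3 / s"
  proof -
    have "p / 2 * q\<^sup>2 - p * (p - 2) / (6 * \<gamma>) * q ^ 3 / s
      = s\<^sup>2 * (y\<^sup>2 - p * \<gamma> / (p - 1) * y + \<gamma>\<^sup>2 * (1 - (p - 2) * u + (p - 2) * (p - 2 + 1) / 2 * u\<^sup>2 - (p - 2) * (p - 2 + 1) * (p - 2 + 2) / 6 * u ^ 3) / (p - 1))"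
      using k s \<gamma> unfolding y qu pk by (simp add: field_simps power2_eq_square power3_eq_cube)
    also have "\<dots> \<le> s\<^sup>2 * (y\<^sup>2 - p * \<gamma> / (p - 1) * y + \<gamma> powr p * y powr (2 - p) / (p - 1))"
      unfolding yp using powr_minus_ge_cubic[of "p - 2" u] u p
      by (intro add_left_mono divide_right_mono mult_left_mono) auto
    finally show ?thesis .
  qed
  have 2: "\<epsilon> * y powr (2 - p) / (p - 1) \<ge> e - e * (p - 2) / \<gamma> * q / s"
  proof -
    have "e - e * (p - 2) / \<gamma> * q / s = e * (1 - (p - 2) * u)"
      using s \<gamma> by (simp add: u_def field_simps)
    also have "\<dots> \<le> e * (1 + u) powr (- (p - 2))"
      using powr_minus_ge_linear[of "p - 2" u] u p e by (intro mult_left_mono) auto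
    also have "\<dots> = \<epsilon> * y powr (2 - p) / (p - 1)"
      using u \<gamma> by (simp add: y powr_mult e_def)
    finally show ?thesis .
  qed
  have "q ^ 3 \<le> B ^ 3" using q by (intro power_mono) auto
  then have "p * (p - 2) / (6 * \<gamma>) * q ^ 3 / s + e * (p - 2) / \<gamma> * q / s \<le> C / s"
    unfolding C_def add_divide_distrib[symmetric] using p \<gamma> e q s
    by (intro divide_right_mono add_increasing2 add_mono mult_left_mono) auto
  moreover have "s\<^sup>2 * riccati p \<gamma> \<epsilon> s y
     = s\<^sup>2 * (y\<^sup>2 - p * \<gamma> / (p - 1) * y + \<gamma> powr p * y powr (2 - p) / (p - 1)) + \<epsilon> * y powr (2 - p) / (p - 1)"
  proof -
    have "riccati p \<gamma> \<epsilon> s y = (y\<^sup>2 - p * \<gamma> / (p - 1) * y + \<gamma> powr p * y powr (2 - p) / (p - 1)) + \<epsilon> * y powr (2 - p) / (p - 1) / s\<^sup>2"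
      by (simp add: riccati_def distrib_right add_divide_distrib)
    then show ?thesis using s by (simp only: distrib_left) simp
  qed
  ultimately show "p / 2 * q\<^sup>2 + \<epsilon> * \<gamma> powr (2 - p) / (p - 1) - C / s \<le> s\<^sup>2 * riccati p \<gamma> \<epsilon> s (\<gamma> + q / s)"
    using 1 2 unfolding y_def[symmetric] e_def[symmetric] by linarith
qed

section \<open>Long-time behaviour under the Riccati inequality\<close>

text \<open>This lets a margin of order \<open>1 / (ln s)\<^sup>2\<close> absorb the error
  \<open>C / s\<close> of the expansion. The proof substitutes
  \<open>ln x = 2 * ln (sqrt x)\<close>.\<close>

lemma ln_square_over_x_tendsto_0: "((\<lambda>x::real. (ln x)\<^sup>2 / x) \<longlongrightarrow> 0) at_top"
proof (rule Lim_transform_eventually)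
  show "((\<lambda>x. (2 * (ln (sqrt x) / sqrt x))\<^sup>2) \<longlongrightarrow> 0) at_top"
    using tendsto_power[OF tendsto_mult_left[OF filterlim_compose[OF ln_x_over_x_tendsto_0 sqrt_at_top], of 2], of 2]
    by simp
  show "\<forall>\<^sub>F x in at_top. (2 * (ln (sqrt x) / sqrt x))\<^sup>2 = (ln x)\<^sup>2 / x"
    using eventually_gt_at_top[of 0]
    by eventually_elim (simp add: ln_sqrt power_divide)
qed

text \<open>By \<open>riccati_gt\<close>, \<open>y' < - (y - \<gamma>)\<^sup>2\<close>. Once
  \<open>y\<close> is at or below \<open>\<gamma>\<close>, the gap becomes positive and never
  shrinks, so \<open>y\<close> falls at least linearly and reaches 0 in finite time, contradicting
  positivity.\<close>

lemma riccati_subsolution_gt: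
  fixes y y' :: "real \<Rightarrow> real"
  assumes p: "p \<ge> 2" and \<gamma>: "\<gamma> > 0" and \<epsilon>: "\<epsilon> > 0" and s0: "s0 > 0"
    and y: "\<And>s. s > s0 \<Longrightarrow> (y has_real_derivative y' s) (at s)"
    and pos: "\<And>s. s > s0 \<Longrightarrow> y s > 0"
    and ric: "\<And>s. s > s0 \<Longrightarrow> y' s + riccati p \<gamma> \<epsilon> s (y s) \<le> 0"
    and s: "s > s0"
  shows "y s > \<gamma>"
proof (rule ccontr)
  assume "\<not> y s > \<gamma>"
  then have ys: "y s \<le> \<gamma>" by simp
  have y': "y' t < - (y t - \<gamma>)\<^sup>2" if "t > s0" for t
    using riccati_gt[OF p \<gamma> \<epsilon> pos[OF that], of t] ric[OF that] that s0 by auto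
  \<comment> \<open>The gap may be zero at \<open>s\<close> itself; waiting one unit makes it a
    positive \<open>\<delta>\<close>.\<close>
  have "y (s + 1) < y s"
    by (rule DERIV_neg_imp_decreasing[of s "s + 1" y])
      (use s y y' in \<open>auto intro!: exI[where x="y' _"] intro: less_le_trans simp: order.strict_trans2\<close>,
       smt (verit) y' zero_le_power2)
  define \<delta> where "\<delta> = \<gamma> - y (s + 1)"
  have \<delta>: "\<delta> > 0" using \<open>y (s + 1) < y s\<close> ys by (simp add: \<delta>_def)
  have dec: "y t \<le> y (s + 1)" if "t \<ge> s + 1" for t
  proof (rule DERIV_nonpos_imp_nonincreasing[OF that])
    fix x assume "s + 1 \<le> x" "x \<le> t"
    then have "x > s0" using s by simp
    then show "\<exists>D. (y has_real_derivative D) (at x) \<and> D \<le> 0"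
      using y y' by (smt (verit) zero_le_power2)
  qed
  have lin: "y t + \<delta>\<^sup>2 * t \<le> y (s + 1) + \<delta>\<^sup>2 * (s + 1)" if t: "t \<ge> s + 1" for t
  proof (rule DERIV_nonpos_imp_nonincreasing[OF t])
    fix x assume x: "s + 1 \<le> x" "x \<le> t"
    then have "x > s0" using s by simp
    then have "((\<lambda>t. y t + \<delta>\<^sup>2 * t) has_real_derivative y' x + \<delta>\<^sup>2) (at x)"
      by (auto intro!: derivative_eq_intros y)
    moreover have "\<delta>\<^sup>2 \<le> (\<gamma> - y x)\<^sup>2"
      using dec[OF x(1)] \<delta> by (intro power_mono) (auto simp: \<delta>_def)
    then have "y' x + \<delta>\<^sup>2 \<le> 0" using y'[OF \<open>x > s0\<close>] by (simp add: power2_commute)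
    ultimately show "\<exists>D. ((\<lambda>t. y t + \<delta>\<^sup>2 * t) has_real_derivative D) (at x) \<and> D \<le> 0" by blast
  qed
  \<comment> \<open>The time at which the line of slope \<open>- \<delta>\<^sup>2\<close> through
    the value at \<open>s + 1\<close> reaches zero.\<close>
  define t where "t = s + 1 + y (s + 1) / \<delta>\<^sup>2"
  have "y (s + 1) > 0" using pos s by simp
  then have t: "t \<ge> s + 1" by (simp add: t_def)
  have "\<delta>\<^sup>2 * t = \<delta>\<^sup>2 * (s + 1) + y (s + 1)"
    using \<delta> by (simp add: t_def field_simps)
  then have "y t \<le> 0" using lin[OF t] by simp
  then show False using pos[of t] t s by simp
qed

text \<open>At the last point up to \<open>b\<close> where \<open>f \<le> m\<close>, continuity
  forces \<open>f = m\<close>; the negative derivative there pushes \<open>f\<close> below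
  \<open>m\<close> again, so that point was not the last.\<close>

lemma stays_below:
  fixes f f' :: "real \<Rightarrow> real"
  assumes f: "\<And>s. s \<ge> a \<Longrightarrow> (f has_real_derivative f' s) (at s)"
    and a: "f a \<le> m" and neg: "\<And>s. s \<ge> a \<Longrightarrow> f s = m \<Longrightarrow> f' s < 0"
    and b: "b \<ge> a"
  shows "f b \<le> m"
proof (rule ccontr)
  assume fb: "\<not> f b \<le> m"
  define A where "A = {s. a \<le> s \<and> s \<le> b \<and> f s \<le> m}"
  have cf: "continuous_on {a..b} f"
    using f by (intro continuous_at_imp_continuous_on ballI) (auto intro: DERIV_isCont)
  have Aeq: "A = {a..b} \<inter> f -` {..m}" by (auto simp: A_def)
  have "closed A" unfolding Aeq
    using continuous_closed_preimage[OF cf] by simp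
  moreover have "a \<in> A" using a b by (simp add: A_def)
  moreover have "bdd_above A" by (auto simp: A_def)
  ultimately have cA: "Sup A \<in> A" using closed_contains_Sup by blast
  define c where "c = Sup A"
  have c: "a \<le> c" "c \<le> b" "f c \<le> m" using cA by (auto simp: A_def c_def)
  have gt: "f s > m" if "c < s" "s \<le> b" for s
    using that c cSup_upper[OF _ \<open>bdd_above A\<close>, of s] by (force simp: A_def c_def)
  have cb: "c < b" using c fb by (cases "c = b") auto
  have "f c = m"
  proof (rule ccontr)
    assume "f c \<noteq> m"
    then have "f c < m" using c by simp
    moreover have "continuous_on {c..b} f" using cf c continuous_on_subset by fastforce
    ultimately obtain x where "c \<le> x" "x \<le> b" "f x = m"
      using IVT'[of f c m b] fb cb by auto
    with gt[of x] \<open>f c < m\<close> show False by (cases "x = c") auto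
  qed
  then have "f' c < 0" using neg c by blast
  then obtain d where "d > 0" "\<And>h. 0 < h \<Longrightarrow> h < d \<Longrightarrow> f (c + h) < f c"
    using DERIV_neg_dec_right[OF f[OF c(1)]] by blast
  moreover define h where "h = min (d / 2) (b - c)"
  moreover have "0 < h" "h < d" "c + h \<le> b" using cb \<open>d > 0\<close> by (auto simp: h_def)
  ultimately show False using gt[of "c + h"] \<open>f c = m\<close> by (smt (verit))
qed

text \<open>The assumptions \<open>e\<close> and \<open>sum\<close> are Vieta's relations: they turn
  the expansion in \<open>q = s * (y - \<gamma>)\<close> into the product
  \<open>p / 2 * (q - \<beta>) * (q - \<beta>b)\<close>. A value of \<open>q\<close> too far below
  \<open>\<beta>\<close> would start a logarithmic descent through 0, but \<open>q\<close> is
  positive by \<open>riccati_subsolution_gt\<close>.\<close>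

lemma riccati_subsolution_lower_bound:
  fixes y y' :: "real \<Rightarrow> real"
  assumes p: "p \<ge> 2" and \<gamma>: "\<gamma> > 0" and \<epsilon>: "\<epsilon> > 0" and s0: "s0 > 0"
    and y: "\<And>s. s > s0 \<Longrightarrow> (y has_real_derivative y' s) (at s)"
    and pos: "\<And>s. s > s0 \<Longrightarrow> y s > 0"
    and ric: "\<And>s. s > s0 \<Longrightarrow> y' s + riccati p \<gamma> \<epsilon> s (y s) \<le> 0"
    and e: "\<epsilon> * \<gamma> powr (2 - p) / (p - 1) = p / 2 * \<beta> * \<beta>b" and sum: "\<beta> + \<beta>b = 2 / p"
    and \<beta>: "0 < \<beta>" "\<beta> \<le> \<beta>b" and \<tau>: "\<tau> < 0"
  obtains S where "S > s0" "S > 1" "\<And>s. s \<ge> S \<Longrightarrow> y s \<ge> \<gamma> + \<beta> / s + \<tau> / (s * ln s)"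
proof -
  obtain C where C: "C > 0" "\<And>s q. s > 0 \<Longrightarrow> 0 \<le> q \<Longrightarrow> q \<le> \<beta> \<Longrightarrow>
       s\<^sup>2 * riccati p \<gamma> \<epsilon> s (\<gamma> + q / s) \<ge> p / 2 * q\<^sup>2 + \<epsilon> * \<gamma> powr (2 - p) / (p - 1) - C / s"
    using riccati_expansion_ge[OF p \<gamma> \<epsilon>, of \<beta>] \<beta> by auto
  define q where "q = (\<lambda>s. s * (y s - \<gamma>))"
  define q' where "q' = (\<lambda>s. (y s - \<gamma>) + s * y' s)"
  have q: "(q has_real_derivative q' s) (at s)" if "s > s0" for s
    unfolding q_def q'_def by (auto intro!: derivative_eq_intros y[OF that])
  have q0: "q s > 0" if "s > s0" for s
    using riccati_subsolution_gt[OF p \<gamma> \<epsilon> s0 y pos ric that] that s0 by (simp add: q_def)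
  have sq: "s * q' s \<le> - (p / 2) * (\<beta> - q s)\<^sup>2 + C / s" if s: "s > s0" "q s \<le> \<beta>" for s
  proof -
    have "s > 0" using s s0 by simp
    then have yq: "y s = \<gamma> + q s / s" by (simp add: q_def)
    have "s * q' s = q s + s\<^sup>2 * y' s"
      by (simp add: q_def q'_def algebra_simps power2_eq_square)
    also have "\<dots> \<le> q s - s\<^sup>2 * riccati p \<gamma> \<epsilon> s (y s)"
      using mult_left_mono[of "y' s" "- riccati p \<gamma> \<epsilon> s (y s)" "s\<^sup>2"] ric[OF s(1)] by simp
    also have "\<dots> \<le> q s - p / 2 * (q s)\<^sup>2 - p / 2 * \<beta> * \<beta>b + C / s"
      using C(2)[of s "q s"] q0[OF s(1)] s \<open>s > 0\<close> by (simp add: yq e)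
    also have "q s - p / 2 * (q s)\<^sup>2 - p / 2 * \<beta> * \<beta>b = - (p / 2) * ((\<beta> - q s) * (\<beta>b - q s))"
    proof -
      have "q s = p / 2 * (\<beta> + \<beta>b) * q s" using p sum by simp
      then show ?thesis by (simp add: algebra_simps power2_eq_square)
    qed
    \<comment> \<open>For \<open>q \<le> \<beta> \<le> \<beta>b\<close> the second factor is at
      least the first. This treats distinct and coinciding roots together.\<close>
    also have "\<dots> \<le> - (p / 2) * (\<beta> - q s)\<^sup>2"
      using s \<beta> p mult_left_mono[of "\<beta> - q s" "\<beta>b - q s" "\<beta> - q s"] by (simp add: power2_eq_square)
    finally show ?thesis by simp
  qed
  have "eventually (\<lambda>s. (ln s)\<^sup>2 / s < p / 4 * \<tau>\<^sup>2 / C) at_top"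
    using p \<tau> C by (intro order_tendstoD(2)[OF ln_square_over_x_tendsto_0]) auto
  then obtain S1 where S1: "\<And>s. s \<ge> S1 \<Longrightarrow> (ln s)\<^sup>2 / s < p / 4 * \<tau>\<^sup>2 / C"
    by (auto simp: eventually_at_top_linorder)
  define S where "S = max S1 (max (s0 + 1) 2)"
  have lower: "q a \<ge> \<beta> + \<tau> / ln a" if a: "a \<ge> S" for a
  proof (rule ccontr)
    assume "\<not> q a \<ge> \<beta> + \<tau> / ln a"
    define \<delta> where "\<delta> = \<beta> - q a"
    have a1: "a > s0" "a > 1" "a \<ge> S1" using a s0 by (auto simp: S_def)
    have \<delta>1: "\<delta> > - \<tau> / ln a" using \<open>\<not> q a \<ge> \<beta> + \<tau> / ln a\<close> by (simp add: \<delta>_def)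
    moreover have "- \<tau> / ln a > 0" using \<tau> a1 by (simp add: divide_neg_pos)
    ultimately have "\<delta>\<^sup>2 > (- \<tau> / ln a)\<^sup>2" by (intro power_strict_mono) auto
    have \<delta>: "\<delta> > 0" using \<delta>1 \<open>- \<tau> / ln a > 0\<close> by linarith
    have "C / a < p / 4 * \<delta>\<^sup>2"
    proof -
      have "C / a < p / 4 * (\<tau> / ln a)\<^sup>2"
        using S1[OF a1(3)] a1 C by (simp add: field_simps)
      also have "\<dots> \<le> p / 4 * \<delta>\<^sup>2"
        using \<open>\<delta>\<^sup>2 > (- \<tau> / ln a)\<^sup>2\<close> p by (intro mult_left_mono) auto
      finally show ?thesis .
    qed
    \<comment> \<open>Half of the available decay \<open>p / 2 * \<delta>\<^sup>2\<close>; the other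
      half absorbs \<open>C / s\<close>.\<close>
    define c where "c = p / 4 * \<delta>\<^sup>2"
    have c: "c > 0" using p \<delta> by (simp add: c_def)
    have q'b: "s * q' s \<le> - c" if s: "s \<ge> a" "q s \<le> q a" for s
    proof -
      have "s * q' s \<le> - (p / 2) * (\<beta> - q s)\<^sup>2 + C / s"
        using s a1 \<delta> by (intro sq) (auto simp: \<delta>_def)
      moreover have "p / 2 * (\<beta> - q s)\<^sup>2 \<ge> p / 2 * \<delta>\<^sup>2"
        using s \<delta> p by (intro mult_left_mono power_mono) (auto simp: \<delta>_def)
      moreover have "C / s \<le> C / a" using s a1 C by (intro divide_left_mono) auto
      moreover have "C / a < c" "p / 2 * \<delta>\<^sup>2 = 2 * c"
        using \<open>C / a < p / 4 * \<delta>\<^sup>2\<close> by (simp_all add: c_def)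
      ultimately show ?thesis by linarith
    qed
    have q'n: "q' s \<le> - c / s" if "s \<ge> a" "q s \<le> q a" for s
      using q'b[OF that] that a1 by (simp add: field_simps)
    have below: "q s \<le> q a" if "s \<ge> a" for s
    proof (rule stays_below[of a q q' "q a" s])
      fix t assume t: "t \<ge> a" "q t = q a"
      have "- c / t < 0" using c t a1 by simp
      then show "q' t < 0" using q'n[of t] t by simp
    qed (use q a1 that in auto)
    have dec: "q s + c * ln s \<le> q a + c * ln a" if "s \<ge> a" for s
    proof (rule DERIV_nonpos_imp_nonincreasing[OF that])
      fix x assume x: "a \<le> x" "x \<le> s"
      then have "((\<lambda>s. q s + c * ln s) has_real_derivative q' x + c * (1 / x)) (at x)"
        using a1 by (intro DERIV_add q DERIV_cmult DERIV_ln_divide) auto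
      moreover have "q' x + c * (1 / x) \<le> 0" using q'n[OF x(1) below[OF x(1)]] by simp
      ultimately show "\<exists>D. ((\<lambda>s. q s + c * ln s) has_real_derivative D) (at x) \<and> D \<le> 0" by blast
    qed
    \<comment> \<open>The point where the logarithmic upper bound for \<open>q\<close>
      vanishes.\<close>
    define s where "s = a * exp (q a / c)"
    have "q a > 0" using q0 a1 by simp
    then have s: "s \<ge> a" using a1 c by (simp add: s_def)
    have "c * ln s = c * ln a + q a"
      using a1 c by (simp add: s_def ln_mult distrib_left)
    then have "q s \<le> 0" using dec[OF s] by simp
    then show False using q0[of s] s a1 by simp
  qed
  show ?thesis
  proof
    show "S > s0" "S > 1" by (auto simp: S_def)
    fix s assume s: "s \<ge> S"
    then have "s > 1" by (auto simp: S_def)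
    then have "s * (\<gamma> + \<beta> / s + \<tau> / (s * ln s)) = s * \<gamma> + (\<beta> + \<tau> / ln s)"
      by (simp add: distrib_left)
    also have "\<dots> \<le> s * y s"
      using lower[OF s] by (simp add: q_def right_diff_distrib)
    finally show "\<gamma> + \<beta> / s + \<tau> / (s * ln s) \<le> y s"
      using \<open>s > 1\<close> by simp
  qed
qed

section \<open>Roots of the indicial equation\<close>

text \<open>The polynomial is symmetric under \<open>b \<mapsto> 2 / p - b\<close>, so the
  reflection preserves the root set; this gives the sum of the roots even when they coincide. The
  product follows by inserting \<open>\<beta>\<close>, and \<open>K / p - \<epsilon>\<close> is a
  positive multiple of \<open>(\<beta>b - \<beta>)\<^sup>2\<close>, which identifies the double
  root.\<close>

lemma indicial_roots:
  fixes p K \<epsilon> \<beta> \<beta>b :: real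
  assumes p: "p > 0" and K: "K > 0" and \<epsilon>: "0 < \<epsilon>"
    and roots: "{b. K * (2 - b * p) * b = \<epsilon>} = {\<beta>, \<beta>b}" and ord: "\<beta> \<le> \<beta>b"
  shows "\<beta> + \<beta>b = 2 / p" "\<epsilon> = K * p * \<beta> * \<beta>b" "0 < \<beta>" "\<beta> = \<beta>b \<longleftrightarrow> \<epsilon> = K / p"
proof -
  have root: "K * (2 - b * p) * b = \<epsilon> \<longleftrightarrow> b = \<beta> \<or> b = \<beta>b" for b
  proof -
    have "b \<in> {b. K * (2 - b * p) * b = \<epsilon>} \<longleftrightarrow> b \<in> {\<beta>, \<beta>b}" by (simp only: roots)
    then show ?thesis by simp
  qed
  have refl: "2 / p - b = \<beta> \<or> 2 / p - b = \<beta>b" if "b = \<beta> \<or> b = \<beta>b" for b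
  proof -
    have "K * (2 - (2 / p - b) * p) * (2 / p - b) = K * (2 - b * p) * b"
      using p by (simp add: field_simps)
    then show ?thesis using that root by metis
  qed
  show sum: "\<beta> + \<beta>b = 2 / p"
    using refl[of \<beta>] refl[of \<beta>b] ord by auto
  have "K * (2 - \<beta> * p) * \<beta> = \<epsilon>" using root by blast
  moreover have "2 - \<beta> * p = p * \<beta>b"
    using sum p by (simp add: field_simps)
  ultimately show prod: "\<epsilon> = K * p * \<beta> * \<beta>b" by (simp add: mult_ac)
  then have "\<beta> * \<beta>b > 0" using \<epsilon> K p by (smt (verit) mult_pos_pos mult.assoc zero_less_mult_iff)
  moreover have "\<beta>b > 0" using sum ord p by (smt (verit) divide_pos_pos)
  ultimately show "0 < \<beta>" by (simp add: zero_less_mult_iff)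
  have "K / p - \<epsilon> = K * p / 4 * (\<beta>b - \<beta>)\<^sup>2"
  proof -
    have "K / p = K * p / 4 * (2 / p)\<^sup>2" using p by (simp add: power2_eq_square)
    also have "\<dots> = K * p / 4 * (\<beta> + \<beta>b)\<^sup>2" by (simp only: sum)
    finally show ?thesis by (simp add: prod power2_eq_square algebra_simps)
  qed
  then have "\<epsilon> = K / p \<longleftrightarrow> K * p / 4 * (\<beta>b - \<beta>)\<^sup>2 = 0" by linarith
  then show "\<beta> = \<beta>b \<longleftrightarrow> \<epsilon> = K / p" using K p by auto
qed

section \<open>Outer comparison profiles\<close>

text \<open>Take \<open>q = \<beta>b + 2 * X\<close> with \<open>X = (S / s) powr \<sigma>\<close>,
  and \<open>Q\<close> as the integral of \<open>q / s\<close>. Linearised at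
  \<open>\<beta>b\<close>, equality in the Riccati relation makes deviations decay at rate
  \<open>2 * \<sigma>\<close>; the slower rate \<open>\<sigma>\<close> leaves a margin
  \<open>2 * \<sigma> * X\<close>, which beats \<open>C / s\<close> since
  \<open>X \<ge> S / s\<close>. The condition \<open>q S > 2\<close> is for the gluing with the
  inner profile, which corresponds to \<open>q = 2\<close> at \<open>S\<close>.\<close>

lemma growth_profile_noncritical:
  fixes p \<beta> \<beta>b \<tau> C s0 :: real
  assumes p: "p \<ge> 2" and \<beta>: "0 < \<beta>" "\<beta> < \<beta>b" "\<beta> + \<beta>b = 2 / p" and \<tau>: "\<tau> > 0" and C: "C > 0"
  obtains S Q q q' where "S > s0" "q S > 2"
    "\<And>s. s \<ge> S \<Longrightarrow> (Q has_real_derivative q s / s) (at s)"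
    "\<And>s. s \<ge> S \<Longrightarrow> (q has_real_derivative q' s) (at s)"
    "\<And>s. s \<ge> S \<Longrightarrow> 0 < q s" "\<And>s. s \<ge> S \<Longrightarrow> q s \<le> 3"
    "\<And>s. s \<ge> S \<Longrightarrow> s * q' s + p / 2 * ((q s - \<beta>) * (q s - \<beta>b)) > C / s"
    "\<And>s. s \<ge> S \<Longrightarrow> exp (Q s) \<le> s powr \<beta>b * ln s powr \<tau>"
proof -
  define \<sigma> where "\<sigma> = p / 4 * (\<beta>b - \<beta>)"
  have "2 / p \<le> 1" using p by simp
  then have \<beta>b1: "\<beta>b \<le> 1" using \<beta> by linarith
  have "p * \<beta> + p * \<beta>b = 2"
    using \<beta>(3) p by (simp flip: distrib_left)
  moreover have "p * \<beta> > 0" "p * (\<beta>b - \<beta>) > 0" using p \<beta> by auto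
  moreover have "\<sigma> = (p * \<beta>b - p * \<beta>) / 4" by (simp add: \<sigma>_def algebra_simps)
  ultimately have \<sigma>: "0 < \<sigma>" "\<sigma> \<le> 1" by (auto simp: right_diff_distrib)
  \<comment> \<open>\<open>exp 1\<close> ensures \<open>ln s \<ge> 1\<close>, so that the factor
    \<open>ln s powr \<tau>\<close> only helps; the last bound gives
    \<open>2 * \<sigma> * S > C\<close>.\<close>
  define S where "S = max (s0 + 1) (max (exp 1) (C / (2 * \<sigma>) + 1))"
  have S: "S > s0" "S \<ge> exp 1" "S > C / (2 * \<sigma>)" by (auto simp: S_def)
  have S0: "S > 0" using S(2) by (smt (verit) exp_gt_zero)
  define X where "X = (\<lambda>s. S powr \<sigma> * s powr (- \<sigma>))"
  have X: "0 < X s" "X s \<le> 1" "X s \<ge> S / s" if "s \<ge> S" for s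
  proof -
    have e: "X s = (S / s) powr \<sigma>" using that S0 by (simp add: X_def powr_divide powr_minus_divide)
    have b: "0 < S / s" "S / s \<le> 1" using that S0 by auto
    show "0 < X s" using S0 that by (simp add: X_def)
    show "X s \<le> 1" unfolding e using b \<sigma> powr_le1 by simp
    show "X s \<ge> S / s" unfolding e using powr_mono'[of \<sigma> 1 "S / s"] b \<sigma> that S0 by simp
  qed
  have Xd: "(X has_real_derivative - \<sigma> * X s / s) (at s)" if "s > 0" for s
    using DERIV_cmult[OF has_real_derivative_powr[OF that, of "- \<sigma>"], of "S powr \<sigma>"] that
    by (simp add: X_def powr_diff mult_ac)
  show ?thesis
  proof
    show "S > s0" by fact
    show "\<beta>b + 2 * X S > 2"
      using \<beta> S0 by (simp add: X_def flip: powr_add)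
    fix s assume s: "s \<ge> S"
    then have s0: "s > 0" using S0 by simp
    show "((\<lambda>s. \<beta>b * ln s - 2 / \<sigma> * X s) has_real_derivative (\<beta>b + 2 * X s) / s) (at s)"
      using s0 \<sigma> by (auto intro!: derivative_eq_intros Xd simp: field_simps)
    show "((\<lambda>s. \<beta>b + 2 * X s) has_real_derivative - 2 * \<sigma> * X s / s) (at s)"
      using s0 by (auto intro!: derivative_eq_intros Xd)
    show "0 < \<beta>b + 2 * X s" using X(1)[OF s] \<beta> by simp
    show "\<beta>b + 2 * X s \<le> 3" using X(2)[OF s] \<beta>b1 by simp
    have "C / s < 2 * \<sigma> * S / s"
      using S(3) \<sigma> s0 by (intro divide_strict_right_mono) (auto simp: field_simps)
    also have "\<dots> \<le> 2 * \<sigma> * X s" using X(3)[OF s] \<sigma> by (simp flip: times_divide_eq_right)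
    also have "\<dots> \<le> s * (- 2 * \<sigma> * X s / s) + p / 2 * ((\<beta>b + 2 * X s - \<beta>) * (\<beta>b + 2 * X s - \<beta>b))"
    proof -
      have "s * (- 2 * \<sigma> * X s / s) = - 2 * \<sigma> * X s" using s0 by simp
      moreover have "p / 2 * ((\<beta>b + 2 * X s - \<beta>) * (\<beta>b + 2 * X s - \<beta>b)) = 4 * \<sigma> * X s + 2 * p * (X s)\<^sup>2"
        by (simp add: \<sigma>_def field_simps power2_eq_square)
      ultimately show ?thesis using p by simp
    qed
    finally show "C / s < \<dots>" .
    have "exp 1 \<le> s" using S s by linarith
    then have "ln s \<ge> 1" using s0 by (simp add: ln_ge_iff)
    have "exp (\<beta>b * ln s - 2 / \<sigma> * X s) \<le> exp (\<beta>b * ln s)"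
      using X(1)[OF s] \<sigma> by simp
    also have "\<dots> = s powr \<beta>b * 1" using s0 by (simp add: powr_def)
    also have "\<dots> \<le> s powr \<beta>b * ln s powr \<tau>"
      using \<open>ln s \<ge> 1\<close> \<tau> by (intro mult_left_mono ge_one_powr_ge_zero) auto
    finally show "exp (\<beta>b * ln s - 2 / \<sigma> * X s) \<le> s powr \<beta>b * ln s powr \<tau>" .
  qed
qed

text \<open>At the double root the approach to \<open>1 / p\<close> is only logarithmic:
  \<open>q = 1 / p + \<tau> / l\<close> with \<open>l\<close> a shifted logarithm. The margin is
  \<open>\<kappa> / l\<^sup>2\<close> with
  \<open>\<kappa> = p / 2 * \<tau> * (\<tau> - 2 / p)\<close>, and its positivity is where
  \<open>\<tau> > 2 / p\<close> enters.\<close>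

lemma growth_profile_critical:
  fixes p \<tau> C s0 :: real
  assumes p: "p \<ge> 2" and \<tau>: "\<tau> > 2 / p" and C: "C > 0"
  obtains S Q q q' where "S > s0" "q S > 2"
    "\<And>s. s \<ge> S \<Longrightarrow> (Q has_real_derivative q s / s) (at s)"
    "\<And>s. s \<ge> S \<Longrightarrow> (q has_real_derivative q' s) (at s)"
    "\<And>s. s \<ge> S \<Longrightarrow> 0 < q s" "\<And>s. s \<ge> S \<Longrightarrow> q s \<le> 3"
    "\<And>s. s \<ge> S \<Longrightarrow> s * q' s + p / 2 * ((q s - 1 / p) * (q s - 1 / p)) > C / s"
    "\<And>s. s \<ge> S \<Longrightarrow> exp (Q s) \<le> s powr (1 / p) * ln s powr \<tau>"
proof -
  define D where "D = \<tau> / 2"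
  have "2 / p > 0" using p by simp
  then have \<tau>0: "\<tau> > 0" using \<tau> by linarith
  then have D: "D > 0" by (simp add: D_def)
  define \<kappa> where "\<kappa> = p / 2 * \<tau>\<^sup>2 - \<tau>"
  have "\<kappa> = p / 2 * \<tau> * (\<tau> - 2 / p)" using p by (simp add: \<kappa>_def power2_eq_square algebra_simps)
  moreover have "p / 2 * \<tau> * (\<tau> - 2 / p) > 0"
    using p \<tau> \<tau>0 by (intro mult_pos_pos) auto
  ultimately have \<kappa>: "\<kappa> > 0" by simp
  have "eventually (\<lambda>s. (ln s)\<^sup>2 / s < \<kappa> / C) at_top"
    using \<kappa> C by (intro order_tendstoD(2)[OF ln_square_over_x_tendsto_0]) auto
  then obtain S1 where S1: "\<And>s. s \<ge> S1 \<Longrightarrow> (ln s)\<^sup>2 / s < \<kappa> / C"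
    by (auto simp: eventually_at_top_linorder)
  define S where "S = max (s0 + 1) (max (exp D) S1)"
  have S: "S > s0" "S \<ge> exp D" "S \<ge> S1" by (auto simp: S_def)
  have S0: "S > 0" using S(2) by (smt (verit) exp_gt_zero)
  have lnS: "ln S \<ge> D" using S S0 by (simp add: ln_ge_iff)
  \<comment> \<open>The shift makes \<open>l S = \<tau> / 2\<close>, hence
    \<open>q S = 1 / p + 2\<close>; \<open>S \<ge> exp D\<close> keeps \<open>l\<close> below
    \<open>ln\<close>, as the growth bound on \<open>Q\<close> requires.\<close>
  define l where "l = (\<lambda>s. ln s - ln S + D)"
  have l: "D \<le> l s" "0 < l s" "l s \<le> ln s" if "s \<ge> S" for s
    using that S0 D lnS by (auto simp: l_def add_nonneg_pos)
  have ld: "(l has_real_derivative 1 / s) (at s)" if "s > 0" for s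
    unfolding l_def using that by (auto intro!: derivative_eq_intros)
  show ?thesis
  proof
    show "S > s0" by fact
    show "1 / p + \<tau> / l S > 2"
      using p \<tau>0 by (simp add: l_def D_def)
    fix s assume s: "s \<ge> S"
    then have s0: "s > 0" using S0 by simp
    note l = l[OF s]
    show "((\<lambda>s. 1 / p * ln s + \<tau> * ln (l s)) has_real_derivative (1 / p + \<tau> / l s) / s) (at s)"
      using s0 l p by (auto intro!: derivative_eq_intros ld simp: field_simps)
    show "((\<lambda>s. 1 / p + \<tau> / l s) has_real_derivative - \<tau> / (s * (l s)\<^sup>2)) (at s)"
      using s0 l by (auto intro!: derivative_eq_intros ld simp: field_simps power2_eq_square)
    show "0 < 1 / p + \<tau> / l s" using p \<tau>0 l by (intro add_pos_pos) auto
    have "\<tau> / l s \<le> 2" using l \<tau>0 by (simp add: D_def field_simps)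
    moreover have "1 / p \<le> 1" using p by simp
    ultimately show "1 / p + \<tau> / l s \<le> 3" by linarith
    have "ln s > 0" using l by linarith
    have "C / s < \<kappa> / (ln s)\<^sup>2"
      using S1[of s] S s s0 C \<open>ln s > 0\<close> by (simp add: field_simps)
    also have "\<dots> \<le> \<kappa> / (l s)\<^sup>2"
      using \<kappa> l \<open>ln s > 0\<close> by (intro divide_left_mono power_mono) auto
    also have "\<dots> = s * (- \<tau> / (s * (l s)\<^sup>2)) + p / 2 * ((1 / p + \<tau> / l s - 1 / p) * (1 / p + \<tau> / l s - 1 / p))"
    proof -
      have "s * (- \<tau> / (s * (l s)\<^sup>2)) = - \<tau> / (l s)\<^sup>2" using s0 by simp
      then show ?thesis by (simp add: \<kappa>_def power2_eq_square diff_divide_distrib)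
    qed
    finally show "C / s < \<dots>" .
    have "exp (1 / p * ln s + \<tau> * ln (l s)) = s powr (1 / p) * l s powr \<tau>"
      using s0 l by (simp add: powr_def exp_add)
    also have "\<dots> \<le> s powr (1 / p) * ln s powr \<tau>"
      using l \<tau>0 by (intro mult_left_mono powr_mono2) auto
    finally show "exp (1 / p * ln s + \<tau> * ln (l s)) \<le> s powr (1 / p) * ln s powr \<tau>" .
  qed
qed

section \<open>A maximum principle on annuli\<close>

text \<open>At an interior maximum of the quotient with value \<open>c\<close>, the profile
  \<open>f / c\<close> touches \<open>w\<close> from below, which contradicts the strict Riccati
  inequality. The function \<open>f\<close> is kept apart from \<open>exp (H (ln r))\<close> because
  it may vanish on the boundary, where \<open>H\<close> degenerates; only continuity is asked for
  there.\<close>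

lemma quotient_max_on_boundary:
  fixes w :: "real^'n::finite \<Rightarrow> real" and f H y y' :: "real \<Rightarrow> real"
  assumes sup: "supersol p CH \<epsilon> r0 w" and pos: "\<And>x. norm x \<ge> r0 \<Longrightarrow> w x > 0"
    and r0: "1 < r0" "r0 \<le> a" and f: "continuous_on {a..b} f"
    and fH: "\<And>r. a < r \<Longrightarrow> r < b \<Longrightarrow> f r = exp (H (ln r))"
    and H: "\<And>r. a < r \<Longrightarrow> r < b \<Longrightarrow> (H has_real_derivative y (ln r)) (at (ln r))"
    and y: "\<And>r. a < r \<Longrightarrow> r < b \<Longrightarrow> (y has_real_derivative y' (ln r)) (at (ln r))"
    and y0: "\<And>r. a < r \<Longrightarrow> r < b \<Longrightarrow> y (ln r) > 0"
    and p: "p \<ge> 2" and \<gamma>: "\<gamma> = (p - real CARD('n)) / p" and CH: "CH = \<gamma> powr p"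
    and strict: "\<And>r. a < r \<Longrightarrow> r < b \<Longrightarrow> y' (ln r) + riccati p \<gamma> \<epsilon> (ln r) (y (ln r)) > 0"
    and x: "a \<le> norm x" "norm x \<le> b"
  obtains z where "norm z = a \<or> norm z = b" "f (norm x) / w x \<le> f (norm z) / w z"
proof -
  define K where "K = {x::real^'n. a \<le> norm x \<and> norm x \<le> b}"
  have C2: "C2_ext r0 w" using sup by (simp add: supersol_def)
  have "K = cball 0 b \<inter> {x. a \<le> norm x}" by (auto simp: K_def)
  then have "compact K"
    by (auto intro!: compact_Int_closed closed_Collect_le continuous_intros)
  moreover have "x \<in> K" using x by (simp add: K_def)
  moreover have "continuous_on K (\<lambda>x. f (norm x) / w x)"
  proof (intro continuous_on_divide)
    show "continuous_on K (\<lambda>x. f (norm x))"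
      by (rule continuous_on_compose2[OF f]) (auto simp: K_def intro!: continuous_intros)
    show "continuous_on K w" using r0 by (intro C2_ext_continuous_on[OF C2]) (auto simp: K_def)
    show "\<forall>x\<in>K. w x \<noteq> 0"
    proof
      fix x assume "x \<in> K"
      then have "norm x \<ge> r0" using r0 by (simp add: K_def)
      from pos[OF this] show "w x \<noteq> 0" by simp
    qed
  qed
  ultimately obtain z where z: "z \<in> K" "\<And>u. u \<in> K \<Longrightarrow> f (norm u) / w u \<le> f (norm z) / w z"
    using continuous_attains_sup[of K "\<lambda>x. f (norm x) / w x"] by blast
  have "norm z = a \<or> norm z = b"
  proof (rule ccontr)
    assume "\<not> (norm z = a \<or> norm z = b)"
    then have zi: "a < norm z" "norm z < b" using z by (auto simp: K_def)
    define c where "c = f (norm z) / w z"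
    have wz: "w z > 0" using pos zi r0 by simp
    have c: "c > 0" using wz fH[OF zi] by (simp add: c_def)
    have Hc: "exp (H (ln r) - ln c) = f r / c" if "a < r" "r < b" for r
      using fH[OF that] c by (simp add: exp_diff)
    have "y' (ln (norm z)) + riccati p \<gamma> \<epsilon> (ln (norm z)) (y (ln (norm z))) \<le> 0"
    proof (rule supersol_touched_riccati[OF C2 r0 zi _ y[OF zi] y0[OF zi] _ _ p \<gamma> CH, where H="\<lambda>s. H s - ln c"])
      show "((\<lambda>s. H s - ln c) has_real_derivative y (ln r)) (at (ln r))" if "a < r" "r < b" for r
        using H[OF that] by (auto intro!: derivative_eq_intros)
      show "exp (H (ln (norm u)) - ln c) \<le> w u" if "a < norm u" "norm u < b" for u
      proof -
        have "f (norm u) / w u \<le> c" using z(2)[of u] that by (simp add: K_def c_def)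
        moreover have "w u > 0" using pos that r0 by simp
        ultimately show ?thesis using c by (simp add: Hc[OF that] field_simps)
      qed
      show "exp (H (ln (norm z)) - ln c) = w z"
        using wz c by (simp add: Hc[OF zi]) (auto simp: c_def)
      show "Lop p CH \<epsilon> w z \<ge> 0" using sup zi r0 by (simp add: supersol_def)
    qed
    then show False using strict[OF zi] by simp
  qed
  then show ?thesis using that z(2) \<open>x \<in> K\<close> by blast
qed

section \<open>Lower bound for increasing radial supersolutions\<close>

text \<open>A radial supersolution touches itself at every point, so its logarithmic derivative
  \<open>y\<close> satisfies the Riccati inequality everywhere; monotonicity makes \<open>y\<close>
  positive. Integrating the bound on \<open>y\<close> controls large \<open>|x|\<close>, and
  compactness the rest.\<close>

lemma radial_supersol_lower_bound:
  fixes v :: "real^'n::finite \<Rightarrow> real"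
  assumes p: "p \<ge> 2" and \<gamma>: "\<gamma> = (p - real CARD('n)) / p" "\<gamma> > 0" and CH: "CH = \<gamma> powr p"
    and \<epsilon>: "\<epsilon> > 0" and r0: "r0 > exp 1"
    and e: "\<epsilon> * \<gamma> powr (2 - p) / (p - 1) = p / 2 * \<beta> * \<beta>b" and sum: "\<beta> + \<beta>b = 2 / p"
    and \<beta>: "0 < \<beta>" "\<beta> \<le> \<beta>b" and \<tau>: "\<tau> < 0"
    and pos: "\<And>x. norm x \<ge> r0 \<Longrightarrow> v x > 0"
    and rad: "radial_strict_incr r0 v" and sup: "supersol p CH \<epsilon> r0 v"
  obtains C where "C > 0"
    "\<And>x. norm x \<ge> r0 \<Longrightarrow> norm x powr \<gamma> * ln (norm x) powr \<beta> * ln (ln (norm x)) powr \<tau> \<le> C * v x"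
proof -
  have C2: "C2_ext r0 v" using sup by (simp add: supersol_def)
  have r01: "r0 > 1" "r0 > 0" using r0 by (smt (verit) one_less_exp_iff)+
  have s0: "ln r0 > 1" using r0 r01 by (metis exp_gt_zero ln_exp ln_less_cancel_iff)
  obtain \<phi> where \<phi>: "\<And>x. norm x \<ge> r0 \<Longrightarrow> v x = \<phi> (norm x)"
    "\<And>r. r \<ge> r0 \<Longrightarrow> \<exists>d>0. (\<phi> has_real_derivative d) (at r within {r0..})"
    using rad unfolding radial_strict_incr_def by blast
  define k :: 'n where "k = undefined"
  define n :: "real^'n" where "n = axis k 1"
  have nn: "norm n = 1" by (simp add: n_def)
  have \<phi>pos: "\<phi> r > 0" if "r \<ge> r0" for r
    using pos[of "r *\<^sub>R n"] \<phi>(1)[of "r *\<^sub>R n"] nn that r01 by simp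
  \<comment> \<open>Monotonicity supplies just one derivative of \<open>\<phi>\<close>. Writing it
    as a partial derivative of \<open>v\<close> along a coordinate ray gives access to the second
    derivatives of \<open>v\<close>.\<close>
  define \<phi>1 where "\<phi>1 = (\<lambda>r. pd k v (r *\<^sub>R n))"
  have d1: "(\<phi> has_real_derivative \<phi>1 r) (at r)" if r: "r > r0" for r
  proof (rule has_field_derivative_transform_within_open)
    show "((\<lambda>t. v (0 + t *\<^sub>R n)) has_real_derivative \<phi>1 r) (at r)"
      using has_real_derivative_grad_line[of v 0 r n] C2_ext_differentiable(1)[OF C2, of "r *\<^sub>R n"] r r01 nn
      by (simp add: \<phi>1_def n_def inner_axis grad_def)
    show "v (0 + t *\<^sub>R n) = \<phi> t" if "t \<in> {r0<..}" for t
      using \<phi>(1)[of "t *\<^sub>R n"] nn r01 that by simp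
  qed (use r in auto)
  have \<phi>1pos: "\<phi>1 r > 0" if r: "r > r0" for r
  proof -
    obtain d where "d > 0" "(\<phi> has_real_derivative d) (at r within {r0..})"
      using \<phi>(2)[of r] r by auto
    moreover have "at r within {r0..} = at r" using r by (intro at_within_interior) auto
    ultimately show ?thesis using DERIV_unique[OF d1[OF r]] by auto
  qed
  have d2: "\<exists>D. (\<phi>1 has_real_derivative D) (at r)" if "r > r0" for r
  proof -
    have "pd k v differentiable (at (0 + r *\<^sub>R n))"
      using C2_ext_differentiable(2)[OF C2, of "r *\<^sub>R n"] that r01 nn by simp
    from has_real_derivative_grad_line[OF this] show ?thesis unfolding \<phi>1_def by auto
  qed
  define H where "H = (\<lambda>s. ln (\<phi> (exp s)))"
  define y where "y = (\<lambda>s. exp s * \<phi>1 (exp s) / \<phi> (exp s))"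
  have es: "exp s > r0" if "s > ln r0" for s
    using that r01 by (metis exp_less_cancel_iff exp_ln)
  have el: "exp (ln r) = r" "ln r > ln r0" if "r > r0" for r
    using that r01 by (auto intro!: exp_ln)
  have H: "(H has_real_derivative y s) (at s)" if "s > ln r0" for s
  proof -
    have "((\<lambda>s. \<phi> (exp s)) has_real_derivative \<phi>1 (exp s) * exp s) (at s)"
      by (rule DERIV_chain2[where f=\<phi> and g=exp, OF d1[OF es[OF that]]]) (rule DERIV_exp)
    from DERIV_chain2[OF DERIV_ln_divide this] show ?thesis
      using \<phi>pos es[OF that] by (simp add: H_def y_def mult_ac)
  qed
  have ex_y: "\<exists>D. (y has_real_derivative D) (at s)" if "s > ln r0" for s
  proof -
    obtain D where "(\<phi>1 has_real_derivative D) (at (exp s))" using d2[OF es[OF \<open>s > ln r0\<close>]] by blast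
    then have "((\<lambda>s. \<phi>1 (exp s)) has_real_derivative D * exp s) (at s)"
      by (rule DERIV_chain2[where f=\<phi>1 and g=exp]) (rule DERIV_exp)
    from DERIV_mult[OF DERIV_exp this]
    have 1: "((\<lambda>s. exp s * \<phi>1 (exp s)) has_real_derivative exp s * \<phi>1 (exp s) + D * exp s * exp s) (at s)" .
    have "((\<lambda>s. \<phi> (exp s)) has_real_derivative \<phi>1 (exp s) * exp s) (at s)"
      by (rule DERIV_chain2[where f=\<phi> and g=exp, OF d1[OF es[OF that]]]) (rule DERIV_exp)
    moreover have "\<phi> (exp s) \<noteq> 0" using \<phi>pos[of "exp s"] es[OF that] by simp
    ultimately show ?thesis unfolding y_def using DERIV_divide[OF 1] by blast
  qed
  define y' where "y' = (\<lambda>s. SOME D. (y has_real_derivative D) (at s))"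
  have y: "(y has_real_derivative y' s) (at s)" if "s > ln r0" for s
    unfolding y'_def using someI_ex[OF ex_y[OF that]] .
  have ypos: "y s > 0" if "s > ln r0" for s
    using \<phi>1pos \<phi>pos es[OF that] by (simp add: y_def)
  have ric: "y' s + riccati p \<gamma> \<epsilon> s (y s) \<le> 0" if s: "s > ln r0" for s
  proof -
    define x0 where "x0 = exp s *\<^sub>R n"
    have nx: "norm x0 = exp s" using nn by (simp add: x0_def)
    have HE: "exp (H (ln (norm x))) = v x" if "norm x > r0" for x
      using \<phi>pos[of "norm x"] \<phi>(1)[of x] that by (simp add: H_def el)
    have "y' (ln (norm x0)) + riccati p \<gamma> \<epsilon> (ln (norm x0)) (y (ln (norm x0))) \<le> 0"
    proof (rule supersol_touched_riccati[OF C2 r01(1) order.refl, where b="norm x0 + 1" and H=H])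
      show "(H has_real_derivative y (ln r)) (at (ln r))" if "r0 < r" for r
        using H el that by blast
      show "Lop p CH \<epsilon> v x0 \<ge> 0" using sup es[OF s] by (simp add: supersol_def nx)
    qed (use es[OF s] y[OF s] ypos[OF s] HE HE[of x0] p \<gamma> CH in \<open>auto simp: nx\<close>)
    then show ?thesis by (simp add: nx)
  qed
  obtain S where S: "S > ln r0" "S > 1" "\<And>s. s \<ge> S \<Longrightarrow> y s \<ge> \<gamma> + \<beta> / s + \<tau> / (s * ln s)"
    by (rule riccati_subsolution_lower_bound[OF p \<gamma>(2) \<epsilon> less_trans[OF zero_less_one s0] y ypos ric e sum \<beta> \<tau>]) blast+
  \<comment> \<open>The logarithm of the numerator divided by \<open>v\<close>, as a function of
    \<open>s = ln r\<close>; beyond \<open>S\<close> it is nonincreasing.\<close>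
  define G where "G = (\<lambda>s. \<gamma> * s + \<beta> * ln s + \<tau> * ln (ln s) - H s)"
  have G: "G s \<le> G S" if "s \<ge> S" for s
  proof (rule DERIV_nonpos_imp_nonincreasing[OF that])
    fix t assume t: "S \<le> t" "t \<le> s"
    then have t1: "t > 1" "t > ln r0" using S by auto
    have "(G has_real_derivative \<gamma> + \<beta> / t + \<tau> / (t * ln t) - y t) (at t)"
      unfolding G_def using t1
      by (auto intro!: derivative_eq_intros H simp: field_simps)
    then show "\<exists>D. (G has_real_derivative D) (at t) \<and> D \<le> 0" using S(3)[OF t(1)] by auto
  qed
  define num where "num = (\<lambda>r. r powr \<gamma> * ln r powr \<beta> * ln (ln r) powr \<tau>)"
  have outer: "num r \<le> exp (G S) * \<phi> r" if "r \<ge> exp S" for r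
  proof -
    have r: "r > r0" "r > 0" using that es[OF S(1)] r01 by auto
    have "ln r \<ge> S" using that r by (simp add: ln_ge_iff)
    note r = this r
    have "num r = exp (\<gamma> * ln r + \<beta> * ln (ln r) + \<tau> * ln (ln (ln r)))"
    proof -
      have "ln r > 1" using r(1) S(2) by linarith
      then have "ln r > 0" "ln (ln r) > 0" by simp_all
      then show ?thesis using r by (simp add: num_def powr_def exp_add)
    qed
    also have "\<dots> \<le> exp (G S + H (ln r))"
      using G[OF r(1)] by (simp add: G_def)
    also have "\<dots> = exp (G S) * \<phi> r" using r \<phi>pos[of r] by (simp add: exp_add H_def el)
    finally show ?thesis .
  qed
  \<comment> \<open>The bounded range is handled by compactness: \<open>r0 > exp 1\<close> keeps
    \<open>ln (ln r)\<close> positive, and the one-sided derivative gives continuity of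
    \<open>\<phi>\<close> at \<open>r0\<close>.\<close>
  have "continuous_on {r0..exp S} (\<lambda>r. num r / \<phi> r)"
    unfolding num_def
  proof (intro continuous_intros)
    have "continuous_on {r0..} \<phi>"
      unfolding continuous_on_eq_continuous_within
      using \<phi>(2) by (force dest: DERIV_continuous)
    then show "continuous_on {r0..exp S} \<phi>" by (rule continuous_on_subset) auto
    show "\<forall>r\<in>{r0..exp S}. \<phi> r \<noteq> 0" using \<phi>pos by force
    show "\<forall>r\<in>{r0..exp S}. ln (ln r) \<noteq> 0" "\<forall>r\<in>{r0..exp S}. ln r \<noteq> 0"
    proof -
      have "ln r > 1" if "r \<in> {r0..exp S}" for r
        using s0 that r01 by (smt (verit) atLeastAtMost_iff ln_mono)
      then show "\<forall>r\<in>{r0..exp S}. ln (ln r) \<noteq> 0" "\<forall>r\<in>{r0..exp S}. ln r \<noteq> 0" by force+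
    qed
  qed (use r01 in auto)
  then have "bounded ((\<lambda>r. num r / \<phi> r) ` {r0..exp S})"
    by (intro compact_imp_bounded compact_continuous_image) auto
  then obtain B where B: "\<And>r. r \<in> {r0..exp S} \<Longrightarrow> \<bar>num r / \<phi> r\<bar> \<le> B"
    unfolding bounded_iff real_norm_def by blast
  show ?thesis
  proof
    show "max B (exp (G S)) > 0" by (simp add: less_max_iff_disj)
    fix x :: "real^'n" assume x: "norm x \<ge> r0"
    note \<phi>x = \<phi>pos[OF x]
    have "num (norm x) \<le> max B (exp (G S)) * \<phi> (norm x)"
    proof (cases "norm x \<le> exp S")
      case True
      then have "num (norm x) / \<phi> (norm x) \<le> B"
        using x by (intro order_trans[OF abs_ge_self B]) simp
      then have "num (norm x) \<le> B * \<phi> (norm x)" using \<phi>x by (simp add: field_simps)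
      also have "\<dots> \<le> max B (exp (G S)) * \<phi> (norm x)" using \<phi>x by (intro mult_right_mono) auto
      finally show ?thesis .
    next
      case False
      then have "num (norm x) \<le> exp (G S) * \<phi> (norm x)" by (intro outer) simp
      also have "\<dots> \<le> max B (exp (G S)) * \<phi> (norm x)" using \<phi>x by (intro mult_right_mono) auto
      finally show ?thesis .
    qed
    then show "norm x powr \<gamma> * ln (norm x) powr \<beta> * ln (ln (norm x)) powr \<tau> \<le> max B (exp (G S)) * v x"
      by (simp add: num_def \<phi>(1)[OF x])
  qed
qed

section \<open>Positive upper limit for arbitrary positive supersolutions\<close>

lemma supersol_limsup_pos:
  fixes w :: "real^'n::finite \<Rightarrow> real"
  assumes p: "p \<ge> 2" and \<gamma>: "\<gamma> = (p - real CARD('n)) / p" "\<gamma> > 0" and CH: "CH = \<gamma> powr p"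
    and \<epsilon>: "\<epsilon> > 0" and r0: "r0 > 1"
    and e: "\<epsilon> * \<gamma> powr (2 - p) / (p - 1) = p / 2 * \<beta> * \<beta>b" and sum: "\<beta> + \<beta>b = 2 / p"
    and \<beta>: "0 < \<beta>" "\<beta> \<le> \<beta>b" and \<tau>: "\<beta> < \<beta>b \<and> \<tau> > 0 \<or> \<beta> = \<beta>b \<and> \<tau> > 2 / p"
    and pos: "\<And>x. norm x \<ge> r0 \<Longrightarrow> w x > 0"
    and sup: "supersol p CH \<epsilon> r0 w"
  shows "Limsup at_infinity (\<lambda>x. ereal (norm x powr \<gamma> * ln (norm x) powr \<beta>b * ln (ln (norm x)) powr \<tau> / w x)) > 0"
proof (rule ccontr)
  define U where "U = (\<lambda>x. norm x powr \<gamma> * ln (norm x) powr \<beta>b * ln (ln (norm x)) powr \<tau> / w x)"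
  assume "\<not> ?thesis"
  then have lim: "Limsup at_infinity (\<lambda>x. ereal (U x)) \<le> 0" by (simp add: U_def not_less)
  have C2: "C2_ext r0 w" using sup by (simp add: supersol_def)
  obtain C where C: "C > 0" "\<And>s q. s > 0 \<Longrightarrow> 0 \<le> q \<Longrightarrow> q \<le> 3 \<Longrightarrow>
       s\<^sup>2 * riccati p \<gamma> \<epsilon> s (\<gamma> + q / s) \<ge> p / 2 * q\<^sup>2 + \<epsilon> * \<gamma> powr (2 - p) / (p - 1) - C / s"
    using riccati_expansion_ge[OF p \<gamma>(2) \<epsilon>, of 3] by auto
  \<comment> \<open>\<open>S > 2 * ln r0\<close> places the inner sphere \<open>ln r = S / 2\<close>
    inside the domain.\<close>
  obtain S Q q q' where S: "S > 2 * ln r0" and qS: "q S > 2"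
    and Q: "\<And>s. s \<ge> S \<Longrightarrow> (Q has_real_derivative q s / s) (at s)"
    and q: "\<And>s. s \<ge> S \<Longrightarrow> (q has_real_derivative q' s) (at s)"
    and q0: "\<And>s. s \<ge> S \<Longrightarrow> 0 < q s" and q3: "\<And>s. s \<ge> S \<Longrightarrow> q s \<le> 3"
    and qric: "\<And>s. s \<ge> S \<Longrightarrow> s * q' s + p / 2 * ((q s - \<beta>) * (q s - \<beta>b)) > C / s"
    and Qb: "\<And>s. s \<ge> S \<Longrightarrow> exp (Q s) \<le> s powr \<beta>b * ln s powr \<tau>"
  proof (cases "\<beta> < \<beta>b")
    case True
    with \<tau> have "\<tau> > 0" by auto
    then show ?thesis
      by (rule growth_profile_noncritical[OF p \<beta>(1) True sum _ C(1), of \<tau> "2 * ln r0"]) (fact that)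
  next
    case False
    with \<tau> \<beta> have "\<beta> = \<beta>b" "\<tau> > 2 / p" by auto
    have "\<beta> = 1 / p" using sum \<open>\<beta> = \<beta>b\<close> by simp
    with \<open>\<beta> = \<beta>b\<close> have "\<beta>b = 1 / p" by simp
    show ?thesis
      by (rule growth_profile_critical[OF p \<open>\<tau> > 2 / p\<close> C(1), of "2 * ln r0"])
        (fact that[unfolded \<open>\<beta> = 1 / p\<close> \<open>\<beta>b = 1 / p\<close>])
  qed
  have lnr0: "ln r0 > 0" using r0 by simp
  have S0: "S > 0" using S lnr0 by simp
  define E where "E = exp S"
  have E: "E > 0" "ln E = S" "E > r0"
  proof -
    have "exp (ln r0) < E" unfolding E_def using S lnr0 by (subst exp_less_cancel_iff) simp
    then show "E > r0" using r0 by simp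
  qed (auto simp: E_def)
  obtain x0 :: "real^'n" where x0: "norm x0 = E" "\<And>z. norm z = E \<Longrightarrow> w x0 \<le> w z"
  proof -
    have "continuous_on (sphere 0 E) w"
      using E by (intro C2_ext_continuous_on[OF C2]) auto
    moreover have "E *\<^sub>R axis undefined 1 \<in> sphere (0::real^'n) E" using E by simp
    ultimately obtain x0 where "x0 \<in> sphere (0::real^'n) E" "\<forall>z\<in>sphere 0 E. w x0 \<le> w z"
      using continuous_attains_inf[OF compact_sphere, of 0 E w] by blast
    then show ?thesis using that by auto
  qed
  have w0: "w x0 > 0" using pos x0 E by simp
  define n where "n = x0 /\<^sub>R E"
  have nn: "norm n = 1" using x0 E by (simp add: n_def)
  define D where "D = grad w x0 \<bullet> n"
  have D: "((\<lambda>r. w (r *\<^sub>R n)) has_real_derivative D) (at E)"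
  proof -
    have "w differentiable (at x0)" using C2_ext_differentiable(1)[OF C2] x0 E by simp
    then show ?thesis
      using has_real_derivative_grad_line[of w 0 E n] E by (simp add: n_def D_def)
  qed
  have rn: "norm (r *\<^sub>R n) = r" if "r > 0" for r using that nn by simp
  \<comment> \<open>\<open>f1\<close> is the profile for the inner annulus, with logarithmic
    derivative \<open>\<gamma> + 1 / (s - S / 2)\<close>, equal to \<open>\<gamma> + 2 / S\<close>
    at \<open>S\<close>; \<open>f3\<close> is the outer one, with \<open>\<gamma> + q S / S\<close>
    there.\<close>
  define f1 where "f1 = (\<lambda>r. exp (\<gamma> * ln r) * (ln r - S / 2))"
  define f3 where "f3 = (\<lambda>r. exp (\<gamma> * ln r + Q (ln r)))"
  define a where "a = exp (S / 2)"
  have a: "a > r0" "a > 0" "a < E" "ln a = S / 2"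
  proof -
    have "r0 = exp (ln r0)" using r0 by simp
    also have "\<dots> < a" using S by (simp add: a_def del: exp_ln)
    finally show "a > r0" .
  qed (use S0 in \<open>auto simp: a_def E_def\<close>)
  have lnS: "ln r \<ge> S" if "r \<ge> E" for r
    using that E by (metis ln_mono)
  have inner: "f1 (norm x) / w x \<le> f1 E / w x0" if x: "a \<le> norm x" "norm x \<le> E" for x :: "real^'n"
  proof -
    have lnr: "ln r > S / 2" if "a < r" for r using a that by (metis ln_less_cancel_iff order.strict_trans)
    obtain z :: "real^'n" where z: "norm z = a \<or> norm z = E" "f1 (norm x) / w x \<le> f1 (norm z) / w z"
    proof (rule quotient_max_on_boundary[OF sup pos r0 less_imp_le[OF a(1)] _ _ _ _ _ p \<gamma>(1) CH _ x,
          of f1 "\<lambda>s. \<gamma> * s + ln (s - S / 2)" "\<lambda>s. \<gamma> + 1 / (s - S / 2)" "\<lambda>s. - 1 / (s - S / 2)\<^sup>2"])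
      show "continuous_on {a..E} f1"
        unfolding f1_def using a by (intro continuous_intros) auto
      fix r assume r: "a < r" "r < E"
      note l = lnr[OF r(1)]
      show "f1 r = exp (\<gamma> * ln r + ln (ln r - S / 2))"
        using l by (simp add: f1_def exp_add)
      show "((\<lambda>s. \<gamma> * s + ln (s - S / 2)) has_real_derivative \<gamma> + 1 / (ln r - S / 2)) (at (ln r))"
        using l by (auto intro!: derivative_eq_intros)
      show "((\<lambda>s. \<gamma> + 1 / (s - S / 2)) has_real_derivative - 1 / (ln r - S / 2)\<^sup>2) (at (ln r))"
        using l by (auto intro!: derivative_eq_intros simp: power2_eq_square)
      show y0: "\<gamma> + 1 / (ln r - S / 2) > 0" using l \<gamma> by (simp add: add_pos_pos)
      \<comment> \<open>The inner profile solves \<open>y' = - (y - \<gamma>)\<^sup>2\<close>, so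
        strictness is exactly \<open>riccati_gt\<close>.\<close>
      show "- 1 / (ln r - S / 2)\<^sup>2 + riccati p \<gamma> \<epsilon> (ln r) (\<gamma> + 1 / (ln r - S / 2)) > 0"
        using riccati_gt[OF p \<gamma>(2) \<epsilon> y0, of "ln r"] l S0 by (simp add: power_divide)
    qed auto
    have f1E: "f1 E > 0" using S0 by (simp add: f1_def E)
    from z(1) have "f1 (norm z) / w z \<le> f1 E / w x0"
    proof
      \<comment> \<open>Here \<open>f1\<close> vanishes, so the maximum is dominated by the outer
        sphere.\<close>
      assume "norm z = a"
      then show ?thesis using f1E w0 by (simp add: f1_def a)
    next
      assume zE: "norm z = E"
      then have "w z \<ge> w x0" using x0 by blast
      then show ?thesis using f1E w0 by (simp add: zE frac_le)
    qed
    with z(2) show ?thesis by simp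
  qed
  have f3b: "f3 (norm x) / w x \<le> U x" if "norm x \<ge> E" for x
  proof -
    have "f3 (norm x) = norm x powr \<gamma> * exp (Q (ln (norm x)))"
      using that E by (auto simp: f3_def powr_def exp_add)
    also have "\<dots> \<le> norm x powr \<gamma> * (ln (norm x) powr \<beta>b * ln (ln (norm x)) powr \<tau>)"
      using Qb[OF lnS[OF that]] by (intro mult_left_mono) auto
    finally show ?thesis
      unfolding U_def using pos[of x] that E by (intro divide_right_mono) (auto simp: mult_ac)
  qed
  have f3E: "f3 E > 0" by (simp add: f3_def)
  define c3 where "c3 = f3 E / w x0"
  have c3: "c3 > 0" using f3E w0 by (simp add: c3_def)
  have "eventually (\<lambda>x. ereal (U x) < ereal c3) at_infinity"
    using lim c3 by (intro Limsup_lessD) (auto intro: le_less_trans)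
  then obtain R where R: "\<And>x. norm x \<ge> R \<Longrightarrow> U x < c3"
    by (auto simp: eventually_at_infinity)
  have outer: "f3 (norm x) / w x \<le> c3" if x: "E \<le> norm x" for x :: "real^'n"
  proof -
    \<comment> \<open>The far sphere lies where the assumption on the upper limit already gives
      \<open>U < c3\<close>, so a maximum there cannot exceed \<open>c3\<close> either.\<close>
    define b where "b = max R (norm x)"
    have b: "b \<ge> R" "norm x \<le> b" by (auto simp: b_def)
    obtain z :: "real^'n" where z: "norm z = E \<or> norm z = b" "f3 (norm x) / w x \<le> f3 (norm z) / w z"
    proof (rule quotient_max_on_boundary[OF sup pos r0 less_imp_le[OF E(3)] _ _ _ _ _ p \<gamma>(1) CH _ x b(2),
          of f3 "\<lambda>s. \<gamma> * s + Q s" "\<lambda>s. \<gamma> + q s / s" "\<lambda>s. (q' s * s - q s) / s\<^sup>2"])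
      have cQ: "continuous_on {S..} Q"
        using Q by (intro continuous_at_imp_continuous_on ballI) (auto intro: DERIV_isCont)
      show "continuous_on {E..b} f3"
        unfolding f3_def
        by (intro continuous_intros continuous_on_compose2[OF cQ]) (use E lnS in auto)
      fix r assume r: "E < r" "r < b"
      define s where "s = ln r"
      have s: "s \<ge> S" "s > 0" using lnS[of r] r S0 by (auto simp: s_def)
      show "f3 r = exp (\<gamma> * ln r + Q (ln r))" by (simp add: f3_def)
      show "((\<lambda>s. \<gamma> * s + Q s) has_real_derivative \<gamma> + q (ln r) / ln r) (at (ln r))"
        using s by (auto intro!: derivative_eq_intros Q simp: s_def)
      show "((\<lambda>s. \<gamma> + q s / s) has_real_derivative (q' (ln r) * ln r - q (ln r)) / (ln r)\<^sup>2) (at (ln r))"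
        using s by (auto intro!: derivative_eq_intros q simp: s_def power2_eq_square)
      show "\<gamma> + q (ln r) / ln r > 0" using s q0[of s] \<gamma> by (simp add: s_def add_pos_pos)
      have "s\<^sup>2 * ((q' s * s - q s) / s\<^sup>2 + riccati p \<gamma> \<epsilon> s (\<gamma> + q s / s))
          = s * q' s - q s + s\<^sup>2 * riccati p \<gamma> \<epsilon> s (\<gamma> + q s / s)"
        using s by (simp add: field_simps)
      also have "\<dots> \<ge> s * q' s - q s + (p / 2 * (q s)\<^sup>2 + p / 2 * \<beta> * \<beta>b - C / s)"
        using C(2)[of s "q s"] q0[of s] q3[of s] s by (simp add: e)
      also have "s * q' s - q s + (p / 2 * (q s)\<^sup>2 + p / 2 * \<beta> * \<beta>b - C / s)
         = s * q' s + p / 2 * ((q s - \<beta>) * (q s - \<beta>b)) - C / s"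
      proof -
        have "q s = p / 2 * (\<beta> + \<beta>b) * q s" using p sum by simp
        then show ?thesis by (simp add: algebra_simps power2_eq_square)
      qed
      finally have "s\<^sup>2 * ((q' s * s - q s) / s\<^sup>2 + riccati p \<gamma> \<epsilon> s (\<gamma> + q s / s)) > 0"
        using qric[OF s(1)] by linarith
      then show "(q' (ln r) * ln r - q (ln r)) / (ln r)\<^sup>2 + riccati p \<gamma> \<epsilon> (ln r) (\<gamma> + q (ln r) / ln r) > 0"
        using s by (simp add: zero_less_mult_iff s_def)
    qed auto
    from z(1) have "f3 (norm z) / w z \<le> c3"
    proof
      assume zE: "norm z = E"
      then have "w z \<ge> w x0" using x0 by blast
      then show ?thesis using f3E w0 by (simp add: zE frac_le c3_def)
    next
      assume "norm z = b"
      then have "norm z \<ge> R" "norm z \<ge> E" using b x by auto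
      then show ?thesis using f3b[of z] R[of z] by simp
    qed
    with z(2) show ?thesis by simp
  qed
  have f1d: "(f1 has_real_derivative f1 E * ((\<gamma> + 2 / S) / E)) (at E)"
    unfolding f1_def using E S0
    by (auto intro!: derivative_eq_intros simp: field_simps)
  have f3d: "(f3 has_real_derivative f3 E * ((\<gamma> + q S / S) / E)) (at E)"
  proof -
    have "((\<lambda>r. Q (ln r)) has_real_derivative q S / S * (1 / E)) (at E)"
      by (rule DERIV_chain2[where f=Q and g=ln]) (use Q[of S] E in \<open>auto intro!: DERIV_ln_divide\<close>)
    then show ?thesis
      unfolding f3_def using E by (auto intro!: derivative_eq_intros simp: field_simps)
  qed
  have wE: "w (E *\<^sub>R n) = w x0" using E by (simp add: n_def)
  have f1E: "f1 E > 0" using S0 by (simp add: f1_def E)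
  \<comment> \<open>Along the ray through \<open>x0\<close>, \<open>w\<close> lies above the
    rescaled \<open>f1\<close> for radii just below \<open>E\<close>, with equality at
    \<open>E\<close>; hence its radial derivative is at most that of the profile.\<close>
  have "D \<le> w x0 * ((\<gamma> + 2 / S) / E)"
  proof (rule ccontr)
    assume less: "\<not> D \<le> w x0 * ((\<gamma> + 2 / S) / E)"
    have "((\<lambda>r. w (r *\<^sub>R n) - w x0 / f1 E * f1 r) has_real_derivative
        D - w x0 / f1 E * (f1 E * ((\<gamma> + 2 / S) / E))) (at E)"
      by (intro DERIV_diff D DERIV_cmult f1d)
    then obtain d where d: "d > 0" "\<And>h. 0 < h \<Longrightarrow> h < d \<Longrightarrow>
        w ((E - h) *\<^sub>R n) - w x0 / f1 E * f1 (E - h) < w (E *\<^sub>R n) - w x0 / f1 E * f1 E"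
      using DERIV_pos_inc_left[of "\<lambda>r. w (r *\<^sub>R n) - w x0 / f1 E * f1 r"] less f1E by force
    define h where "h = min (d / 2) (E - a)"
    have h: "0 < h" "h < d" "a \<le> E - h" using d a by (auto simp: h_def)
    have pw: "w ((E - h) *\<^sub>R n) > 0" using pos rn h a by simp
    have "f1 (E - h) / w ((E - h) *\<^sub>R n) \<le> f1 E / w x0"
      using inner[of "(E - h) *\<^sub>R n"] rn[of "E - h"] h a by simp
    then have "w x0 / f1 E * f1 (E - h) \<le> w ((E - h) *\<^sub>R n)"
      using f1E w0 pw by (simp add: field_simps)
    then show False using d(2)[OF h(1,2)] f1E by (simp add: wE)
  qed
  \<comment> \<open>The same comparison with \<open>f3\<close> just outside the sphere reverses the
    inequality; together the two bounds give \<open>q S \<le> 2\<close>.\<close>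
  moreover have "D \<ge> w x0 * ((\<gamma> + q S / S) / E)"
  proof (rule ccontr)
    assume less: "\<not> D \<ge> w x0 * ((\<gamma> + q S / S) / E)"
    have "((\<lambda>r. w (r *\<^sub>R n) - w x0 / f3 E * f3 r) has_real_derivative
        D - w x0 / f3 E * (f3 E * ((\<gamma> + q S / S) / E))) (at E)"
      by (intro DERIV_diff D DERIV_cmult f3d)
    then obtain d where d: "d > 0" "\<And>h. 0 < h \<Longrightarrow> h < d \<Longrightarrow>
        w ((E + h) *\<^sub>R n) - w x0 / f3 E * f3 (E + h) < w (E *\<^sub>R n) - w x0 / f3 E * f3 E"
      using DERIV_neg_dec_right[of "\<lambda>r. w (r *\<^sub>R n) - w x0 / f3 E * f3 r"] less f3E by force
    define h where "h = d / 2"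
    have h: "0 < h" "h < d" using d by (auto simp: h_def)
    have pw: "w ((E + h) *\<^sub>R n) > 0" using pos rn h E by simp
    have "f3 (E + h) / w ((E + h) *\<^sub>R n) \<le> f3 E / w x0"
      using outer[of "(E + h) *\<^sub>R n"] rn[of "E + h"] h E by (simp add: c3_def)
    then have "w x0 / f3 E * f3 (E + h) \<le> w ((E + h) *\<^sub>R n)"
      using f3E w0 pw by (simp add: field_simps)
    then show False using d(2)[OF h] f3E by (simp add: wE)
  qed
  ultimately have "w x0 * ((\<gamma> + q S / S) / E) \<le> w x0 * ((\<gamma> + 2 / S) / E)" by linarith
  then have "q S \<le> 2" using w0 E S0 by (simp add: divide_le_cancel)
  then show False using qS by simp
qed

theorem theorem4p6:
  fixes p r0 \<epsilon> CH Cs \<beta> \<beta>bar :: real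
  assumes N2: "CARD('n::finite) \<ge> 2"
    and p2: "p \<ge> 2" and pN: "p > real CARD('n)"
    and r0: "r0 > exp 1"
    and CH: "CH = \<bar>(p - real CARD('n)) / p\<bar> powr p"
    and Cs: "Cs = (p - 1) / (2 * p) * \<bar>(p - real CARD('n)) / p\<bar> powr (p - 2)"
    and eps: "0 < \<epsilon>" "\<epsilon> \<le> Cs"
    and roots: "{b::real. 1/2 * \<bar>(p - real CARD('n)) / p\<bar> powr (p - 2) * (p - 1) * (2 - b * p) * b = \<epsilon>}
                  = {\<beta>, \<beta>bar}"
    and ord: "\<beta> \<le> \<beta>bar"
  shows
   "(\<forall>v :: real^'n \<Rightarrow> real.
       (\<forall>x. norm x \<ge> r0 \<longrightarrow> v x > 0) \<and> radial_strict_incr r0 v \<and> strict_supersol p CH \<epsilon> r0 v \<longrightarrow>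
       (\<forall>\<tau><0. \<exists>C>0. \<forall>x. norm x \<ge> r0 \<longrightarrow>
          norm x powr ((p - real CARD('n)) / p) * ln (norm x) powr \<beta> * ln (ln (norm x)) powr \<tau>
            \<le> C * v x))
    \<and>
    (\<forall>w :: real^'n \<Rightarrow> real. \<forall>\<tau>::real.
       (\<forall>x. norm x \<ge> r0 \<longrightarrow> w x > 0) \<and> supersol p CH \<epsilon> r0 w \<and>
       ((\<epsilon> < Cs \<and> \<tau> > 0) \<or> (\<epsilon> = Cs \<and> \<tau> > 2 / p)) \<longrightarrow>
       Limsup at_infinity (\<lambda>x. ereal (norm x powr ((p - real CARD('n)) / p) * ln (norm x) powr \<beta>bar
                                   * ln (ln (norm x)) powr \<tau> / w x)) > 0)"
proof -
  define \<gamma> where "\<gamma> = (p - real CARD('n)) / p"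
  have \<gamma>: "\<gamma> > 0" using p2 pN by (simp add: \<gamma>_def)
  then have abs: "\<bar>(p - real CARD('n)) / p\<bar> = \<gamma>" unfolding \<gamma>_def by (rule abs_of_pos)
  \<comment> \<open>The indicial polynomial becomes \<open>K * (2 - b * p) * b\<close>, with maximum
    \<open>K / p = Cs\<close> at \<open>b = 1 / p\<close>; thus \<epsilon> = \<open>Cs\<close> is
    the double-root case.\<close>
  define K where "K = 1/2 * \<gamma> powr (p - 2) * (p - 1)"
  have K: "K > 0" using \<gamma> p2 by (simp add: K_def)
  have CsK: "Cs = K / p" unfolding Cs abs K_def by simp
  have CH': "CH = \<gamma> powr p" unfolding CH abs ..
  have "p > 0" using p2 by simp
  note r = indicial_roots[OF this K eps(1) roots[unfolded abs, folded K_def] ord]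
  \<comment> \<open>The constant term of the Riccati expansion, expressed through the product of the
    roots.\<close>
  have e: "\<epsilon> * \<gamma> powr (2 - p) / (p - 1) = p / 2 * \<beta> * \<beta>bar"
  proof -
    have "\<gamma> powr (p - 2) * \<gamma> powr (2 - p) = 1" using \<gamma> by (simp flip: powr_add)
    moreover have "1/2 * F * k * p * \<beta> * \<beta>bar * G / k = p / 2 * \<beta> * \<beta>bar * (F * G)"
      if "k > 0" for F G k :: real
      using that by (simp add: field_simps)
    note this[of "p - 1" "\<gamma> powr (p - 2)" "\<gamma> powr (2 - p)"]
    ultimately show ?thesis using p2 by (simp add: r(2) K_def)
  qed
  have r01: "r0 > 1" using r0 by (smt (verit) one_less_exp_iff)
  show ?thesis
  proof (intro conjI allI impI, goal_cases)
    case (1 v \<tau>)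
    then have "supersol p CH \<epsilon> r0 v"
      by (auto simp: supersol_def strict_supersol_def less_imp_le)
    with 1 obtain C where "C > 0" "\<And>x. norm x \<ge> r0 \<Longrightarrow>
        norm x powr \<gamma> * ln (norm x) powr \<beta> * ln (ln (norm x)) powr \<tau> \<le> C * v x"
      using radial_supersol_lower_bound[OF p2 \<gamma>_def \<gamma> CH' eps(1) r0 e r(1,3) ord, of \<tau> v] by blast
    then show ?case unfolding \<gamma>_def by blast
  next
    case (2 w \<tau>)
    have "\<beta> < \<beta>bar \<and> \<tau> > 0 \<or> \<beta> = \<beta>bar \<and> \<tau> > 2 / p"
      using 2 r(4) ord CsK by auto
    from supersol_limsup_pos[OF p2 \<gamma>_def \<gamma> CH' eps(1) r01 e r(1,3) ord this, of w] 2
    show ?case unfolding \<gamma>_def by blast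
  qed
qed

end
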